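(* Let $m$ be a positive integer, $q$ a prime power, and $r$ an integer with $1\le r\le m+1$. Let $(\nu_1,\dots,\nu_{m+1})$ be the $r$th element, in descending lexicographic order, of the set $\Lambda(2,m)$ of $(m+1)$-tuples of nonnegative integers with sum $2$, and let $j:=\min\{i:\nu_i\neq 0\}$. Then $$\max_{F_1,\dots,F_r}|V(F_1,\dots,F_r)| = p_{m-2j}+\sum_{i=j}^{m}\nu_i\,(p_{m-i}-p_{m-i-j}),$$ where the maximum is over all linearly independent homogeneous polynomials $F_1,\dots,F_r$ of degree $2$ in $\mathbb{F}_q[x_0,x_1,\dots,x_m]$. In particular, $$\max_{F_1,\dots,F_r}|V(F_1,\dots,F_r)| = p_{m-1}+\lfloor q^{m-r}\rfloor=\begin{cases}p_{m-1}+q^{m-r} & \text{if } r=1,\dots,m,\\ p_{m-1} & \text{if } r=m+1.\end{cases}$$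
   Context: $\mathbb{F}_q$ is the finite field with $q$ elements. For homogeneous $F_1,\dots,F_r\in\mathbb{F}_q[x_0,\dots,x_m]$, $V(F_1,\dots,F_r)$ is the set of points $P\in\mathbb{P}^m(\mathbb{F}_q)$ (i.e. $\mathbb{F}_q$-rational points) with $F_1(P)=\dots=F_r(P)=0$. Linear independence is over $\mathbb{F}_q$. For $j\in\mathbb{Z}$, $p_j:=|\mathbb{P}^j(\mathbb{F}_q)|=q^j+q^{j-1}+\dots+q+1$ if $j\ge 0$, and $p_j:=0$ if $j<0$. $\Lambda(2,m):=\{(\alpha_1,\dots,\alpha_{m+1})\in\mathbb{Z}^{m+1}:\alpha_1,\dots,\alpha_{m+1}\ge 0,\ \alpha_1+\dots+\alpha_{m+1}=2\}$; in descending lexicographic order its first element is $(2,0,\dots,0)$. An empty sum is $0$. $\lfloor c\rfloor$ is the integer part of the real number $c$. *)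

theory Defs
  imports "HOL-Library.Poly_Mapping" "HOL-Library.List_Lexorder" "HOL-Library.FuncSet"
    "HOL-Library.Cardinality" Complex_Main
begin

text \<open>
  Polynomials in the variables \<open>x\<^sub>0, x\<^sub>1, \<dots>\<close> are finitely supported maps from monomials
  (finitely supported exponent vectors) to coefficients; the ring structure is that of
  \<^theory>\<open>HOL-Library.Poly_Mapping\<close>. These are formal polynomials, not polynomial functions, which
  matters over a finite field.
\<close>

type_synonym 'a mpoly = "(nat \<Rightarrow>\<^sub>0 nat) \<Rightarrow>\<^sub>0 'a"

definition mpoly_smult :: "'a::field \<Rightarrow> 'a mpoly \<Rightarrow> 'a mpoly" where
  "mpoly_smult c F = Poly_Mapping.single 0 c * F"

global_interpretation mpoly: vector_space "mpoly_smult :: 'a::field \<Rightarrow> 'a mpoly \<Rightarrow> 'a mpoly"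
proof
  show "mpoly_smult a (x + y) = mpoly_smult a x + mpoly_smult a y" for a :: 'a and x y
    by (simp add: mpoly_smult_def distrib_left)
  show "mpoly_smult (a + b) x = mpoly_smult a x + mpoly_smult b x" for a b :: 'a and x
    by (simp add: mpoly_smult_def single_add distrib_right)
  show "mpoly_smult a (mpoly_smult b x) = mpoly_smult (a * b) x" for a b :: 'a and x
    by (simp add: mpoly_smult_def mult_single flip: mult.assoc)
  show "mpoly_smult 1 x = x" for x :: "'a mpoly"
    by (simp add: mpoly_smult_def)
qed

definition mpoly_eval :: "(nat \<Rightarrow> 'a::field) \<Rightarrow> 'a mpoly \<Rightarrow> 'a" where
  "mpoly_eval x F = (\<Sum>t\<in>Poly_Mapping.keys F. Poly_Mapping.lookup F t *
     (\<Prod>i\<in>Poly_Mapping.keys t. x i ^ Poly_Mapping.lookup t i))"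

definition homogeneous :: "nat \<Rightarrow> nat \<Rightarrow> 'a::field mpoly \<Rightarrow> bool" where
  "homogeneous m d F \<longleftrightarrow>
     (\<forall>t\<in>Poly_Mapping.keys F. Poly_Mapping.keys t \<subseteq> {0..m} \<and>
       (\<Sum>i\<in>Poly_Mapping.keys t. Poly_Mapping.lookup t i) = d)"

text \<open>
  Vectors of length \<open>m + 1\<close> are functions on \<open>nat\<close> vanishing beyond \<open>m\<close>, and points of projective
  \<open>m\<close>-space are the classes of nonzero vectors up to nonzero scalar multiples.
\<close>

definition nonzero_vecs :: "nat \<Rightarrow> (nat \<Rightarrow> 'a::field) set" where
  "nonzero_vecs m = {x. (\<forall>i>m. x i = 0) \<and> (\<exists>i. x i \<noteq> 0)}"

definition proportional :: "nat \<Rightarrow> ((nat \<Rightarrow> 'a::field) \<times> (nat \<Rightarrow> 'a)) set" where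
  "proportional m = {(x, y). x \<in> nonzero_vecs m \<and> y \<in> nonzero_vecs m \<and>
     (\<exists>c. c \<noteq> 0 \<and> y = (\<lambda>i. c * x i))}"

definition proj_space :: "nat \<Rightarrow> (nat \<Rightarrow> 'a::field) set set" where
  "proj_space m = nonzero_vecs m // proportional m"

text \<open>
  For homogeneous polynomials, vanishing at one representative of a point is the same as vanishing at
  all of them.
\<close>

definition proj_zeros :: "nat \<Rightarrow> 'a::field mpoly set \<Rightarrow> (nat \<Rightarrow> 'a) set set" where
  "proj_zeros m S = {P \<in> proj_space m. \<forall>F\<in>S. \<forall>x\<in>P. mpoly_eval x F = 0}"

definition p_num :: "nat \<Rightarrow> int \<Rightarrow> int" where
  "p_num q j = (if j < 0 then 0 else \<Sum>i=0..nat j. int q ^ i)"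

lemma card_proj_space:
  "int (card (proj_space m :: (nat \<Rightarrow> 'a::{field,finite}) set set)) = p_num CARD('a) (int m)"
proof -
  let ?N = "nonzero_vecs m :: (nat \<Rightarrow> 'a) set"
  let ?Z = "{x :: nat \<Rightarrow> 'a. \<forall>i>m. x i = 0}"
  let ?q = "CARD('a)"
  have q: "?q > 1"
    using card_mono[of UNIV "{0, 1 :: 'a}"] by simp
  have "bij_betw (\<lambda>x. restrict x {0..m}) ?Z ({0..m} \<rightarrow>\<^sub>E UNIV)"
    by (rule bij_betwI[where g = "\<lambda>f i. if i \<le> m then f i else 0"])
      (auto simp: fun_eq_iff restrict_def PiE_def extensional_def)
  then have cZ: "card ?Z = ?q ^ (m + 1)" and fZ: "finite ?Z"
    by (simp_all add: bij_betw_same_card card_PiE bij_betw_finite finite_PiE)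
  have NZ: "?N = ?Z - {\<lambda>_. 0}"
    by (auto simp: nonzero_vecs_def)
  have fN: "finite ?N" and cN: "card ?N = ?q ^ (m + 1) - 1"
    using fZ cZ by (simp_all add: NZ)
  have eq: "equiv ?N (proportional m)"
  proof (rule equivI)
    show "proportional m \<subseteq> ?N \<times> ?N"
      by (auto simp: proportional_def)
    show "refl_on ?N (proportional m)"
      by (auto simp: refl_on_def proportional_def intro!: exI[of _ 1])
    show "sym (proportional m :: ((nat \<Rightarrow> 'a) \<times> _) set)"
    proof (rule symI)
      fix x y :: "nat \<Rightarrow> 'a"
      assume "(x, y) \<in> proportional m"
      then obtain c where c: "x \<in> ?N" "y \<in> ?N" "c \<noteq> 0" "y = (\<lambda>i. c * x i)"
        unfolding proportional_def by blast
      have "inverse c \<noteq> 0" and "x = (\<lambda>i. inverse c * y i)"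
        using c(3) by (simp_all add: c(4) flip: mult.assoc)
      with c(1,2) show "(y, x) \<in> proportional m"
        unfolding proportional_def by blast
    qed
    show "trans (proportional m :: ((nat \<Rightarrow> 'a) \<times> _) set)"
    proof (rule transI)
      fix x y z :: "nat \<Rightarrow> 'a"
      assume "(x, y) \<in> proportional m" "(y, z) \<in> proportional m"
      then obtain c d where c: "x \<in> ?N" "z \<in> ?N" "c \<noteq> 0" "d \<noteq> 0"
          "y = (\<lambda>i. c * x i)" "z = (\<lambda>i. d * y i)"
        unfolding proportional_def by blast
      have "d * c \<noteq> 0" and "z = (\<lambda>i. (d * c) * x i)"
        using c(3,4) by (simp_all add: c(5,6) mult.assoc)
      with c(1,2) show "(x, z) \<in> proportional m"
        unfolding proportional_def by blast
    qed
  qed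
  have cP: "card P = ?q - 1" if P: "P \<in> proj_space m" for P :: "(nat \<Rightarrow> 'a) set"
  proof -
    obtain x where x: "x \<in> ?N" "P = proportional m `` {x}"
      using P by (auto simp: proj_space_def quotient_def)
    then obtain k where k: "x k \<noteq> 0"
      by (auto simp: nonzero_vecs_def)
    have "P = (\<lambda>c i. c * x i) ` (UNIV - {0})"
      using x by (auto simp: proportional_def nonzero_vecs_def)
    moreover have "inj_on (\<lambda>c i. c * x i) (UNIV - {0})"
      using k by (auto simp: inj_on_def fun_eq_iff)
    ultimately show ?thesis
      by (simp add: card_image)
  qed
  have "(?q - 1) * card (proj_space m :: (nat \<Rightarrow> 'a) set set) = card ?N"
  proof -
    have "\<Union> (proj_space m) = ?N"
      using Union_quotient[OF eq] by (simp add: proj_space_def)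
    moreover have "finite (proj_space m :: (nat \<Rightarrow> 'a) set set)"
      using fN calculation finite_UnionD by metis
    moreover have "A \<inter> B = {}" if "A \<in> proj_space m" "B \<in> proj_space m" "A \<noteq> B"
      for A B :: "(nat \<Rightarrow> 'a) set"
      using quotient_disj[OF eq] that unfolding proj_space_def by blast
    ultimately show ?thesis
      using card_partition[of "proj_space m :: (nat \<Rightarrow> 'a) set set" "?q - 1"] fN cP by simp
  qed
  then have "int (?q - 1) * int (card (proj_space m :: (nat \<Rightarrow> 'a) set set)) = int (?q ^ (m + 1) - 1)"
    unfolding cN by (metis of_nat_mult)
  also have "\<dots> = int (?q - 1) * (\<Sum>i\<le>m. int ?q ^ i)"
    using q power_diff_1_eq[of "int ?q" "m + 1"]
    by (simp add: lessThan_Suc_atMost)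
  finally show ?thesis
    using q by (simp add: p_num_def atLeast0AtMost)
qed

definition \<Lambda> :: "nat \<Rightarrow> nat \<Rightarrow> nat list set" where
  "\<Lambda> d m = {\<alpha>. length \<alpha> = m + 1 \<and> sum_list \<alpha> = d}"

text \<open>
  The order on lists is the lexicographic one of \<^theory>\<open>HOL-Library.List_Lexorder\<close>; list positions
  start at 0, whereas \<open>r\<close> counts from 1.
\<close>

definition \<Lambda>_nth :: "nat \<Rightarrow> nat \<Rightarrow> nat \<Rightarrow> nat list" where
  "\<Lambda>_nth d m r = rev (sorted_list_of_set (\<Lambda> d m)) ! (r - 1)"

end

theory Submission
  imports Defs "HOL-Library.Function_Algebras"
begin

text \<open>
  Write \<open>q\<close> for the number of elements of the field. A system \<open>S\<close> of \<open>r\<close> independent quadrics in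
  projective \<open>m\<close>-space spans a space \<open>W\<close> of \<open>q\<^sup>r\<close> quadratic forms on a vector space \<open>V\<close> of
  dimension \<open>n = m + 1\<close>, and counting projective zeros amounts to counting zeros in \<open>V\<close>: if the former
  number is \<open>Z\<close>, the latter is \<open>(q - 1) Z + 1\<close>. In these terms the upper bound says that the
  forms of \<open>W\<close> have at most \<open>q\<^bsup>n-1\<^esup> + (q - 1) q\<^bsup>n-1-r\<^esup>\<close> common zeros, where the second summand is
  absent for \<open>r = n\<close>. It is proved for all \<open>1 \<le> r \<le> n\<close> by induction on \<open>n\<close>
  (\<open>card_common_zeros_le\<close>), restricting \<open>W\<close> to hyperplanes \<open>H = ker l\<close>. Let \<open>U\<close> be the space of
  those \<open>f \<in> W\<close> that vanish on \<open>H\<close>, with \<open>q\<^sup>a\<close> elements; these are the multiples of the linear form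
  \<open>l\<close>. There are two cases.

  \<^item> Some hyperplane has \<open>a \<ge> 1\<close>. Outside \<open>H\<close> all zeros are zeros of \<open>U\<close>, and after division by
    \<open>l\<close> these are given, on the slice \<open>l = 1\<close>, by \<open>a\<close> affine equations that are independent or have no
    solution. So there are at most \<open>(q - 1) q\<^bsup>n-1-a\<^esup>\<close> of them, and none if \<open>a = n\<close>
    (\<open>card_slice_times_card_le\<close>). If \<open>a \<ge> r\<close>, the trivial bound \<open>q\<^bsup>n-1\<^esup>\<close> for the zeros on \<open>H\<close>
    is enough. If \<open>a < r\<close>, then \<open>W\<close> restricts to a space of dimension \<open>r - a\<close> on \<open>H\<close>, and the
    induction hypothesis bounds the zeros there; the two bounds together are worst for \<open>a = 1\<close>, where
    they give what is claimed (\<open>quad_bound_split\<close>).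

  \<^item> Every hyperplane has \<open>a = 0\<close>. Then the induction hypothesis applies on every hyperplane with \<open>r\<close>
    itself (with \<open>n - 1\<close> when \<open>r = n\<close>), and averaging over all hyperplanes gives a bound
    (\<open>average_over_hyperplanes\<close>) that is better than the one required (\<open>quad_bound_average\<close>).

  The forms are treated as functions. A quadratic form over a finite field, even over the field with two
  elements, is determined by its values, as one sees by evaluating at \<open>e\<^sub>i\<close> and at \<open>e\<^sub>i + e\<^sub>j\<close>
  (\<open>poly_fun_eq_0\<close>); hence independence of polynomials is the same as independence of functions.
  Dimensions are expressed by cardinalities throughout: the formulas for the dimension of a kernel and of
  an annihilator become the counting lemmas \<open>card_eq_image_times_kernel\<close> and \<open>card_annihilator\<close>.

  The bound is attained by \<open>x\<^sub>0 x\<^sub>1, \<dots>, x\<^sub>0 x\<^sub>r\<close>, where \<open>x\<^sub>0\<^sup>2\<close> takes the place of \<open>x\<^sub>0 x\<^sub>r\<close> if \<open>r = m + 1\<close>: their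
  zeros are the hyperplane \<open>x\<^sub>0 = 0\<close> and, if \<open>r \<le> m\<close>, the \<open>q\<^bsup>m-r\<^esup>\<close> points with \<open>x\<^sub>0 \<noteq> 0\<close> of the linear
  subspace \<open>x\<^sub>1 = \<dots> = x\<^sub>r = 0\<close>.
  The formula in terms of \<open>\<nu>\<close> gives the same number, because the first \<open>m + 1\<close> tuples of \<open>\<Lambda> 2 m\<close> are
  \<open>(2, 0, \<dots>, 0)\<close>, \<open>(1, 1, 0, \<dots>, 0)\<close>, \<dots>, \<open>(1, 0, \<dots>, 0, 1)\<close>; so \<open>j = 1\<close>, and the differences in the sum
  are powers of \<open>q\<close>.
\<close>

section \<open>Spaces of functions over a finite field\<close>

text \<open>
  Vectors are functions on coordinates, and forms are functions on vectors. The pointwise structure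
  below makes both of them vector spaces, so that a statement about finite subspaces serves for spaces
  of vectors as well as for spaces of forms.
\<close>
definition scl :: "'a::field \<Rightarrow> ('i \<Rightarrow> 'a) \<Rightarrow> 'i \<Rightarrow> 'a" where
  "scl c f = (\<lambda>i. c * f i)"

lemma scl_apply [simp]: "scl c f i = c * f i"
  by (simp add: scl_def)

global_interpretation fn: vector_space "scl :: 'a::field \<Rightarrow> ('i \<Rightarrow> 'a) \<Rightarrow> _"
  by standard (auto simp: scl_def fun_eq_iff algebra_simps)

definition supported_on :: "'b set \<Rightarrow> ('b \<Rightarrow> 'a::zero) set" where
  "supported_on V = {f. \<forall>x. x \<notin> V \<longrightarrow> f x = 0}"

text \<open>
  A function on \<open>V\<close> is represented by its extension by zero. In this way different functions on \<open>V\<close>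
  remain different and equal ones become equal, so that cardinalities of sets of such functions measure
  the dimension of spaces of functions on \<open>V\<close>, and \<open>cut_to H\<close> is restriction to \<open>H\<close>.
\<close>
definition cut_to :: "'b set \<Rightarrow> ('b \<Rightarrow> 'a::zero) \<Rightarrow> 'b \<Rightarrow> 'a" where
  "cut_to V f = (\<lambda>x. if x \<in> V then f x else 0)"

definition dual_on :: "('i \<Rightarrow> 'a::field) set \<Rightarrow> (('i \<Rightarrow> 'a) \<Rightarrow> 'a) set" where
  "dual_on V = {f \<in> supported_on V.
     (\<forall>x\<in>V. \<forall>y\<in>V. f (x + y) = f x + f y) \<and> (\<forall>x\<in>V. \<forall>c. f (scl c x) = c * f x)}"

text \<open>
  Quadratic forms are described without a basis, by their degree and the bilinearity of their
  polarization, so that restricting them to a subspace requires no change of coordinates. Linearity of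
  the polarization in one argument is enough, because it is symmetric.
\<close>
definition quad_on :: "('i \<Rightarrow> 'a::field) set \<Rightarrow> (('i \<Rightarrow> 'a) \<Rightarrow> 'a) set" where
  "quad_on V = {f \<in> supported_on V.
     (\<forall>x\<in>V. \<forall>c. f (scl c x) = c\<^sup>2 * f x) \<and>
     (\<forall>y\<in>V. cut_to V (\<lambda>x. f (x + y) - f x - f y) \<in> dual_on V)}"

lemma finite_supported_on:
  assumes "finite V"
  shows "finite (supported_on V :: ('b \<Rightarrow> 'a::{finite,zero}) set)"
  using finite_set_of_finite_funs[OF assms finite, of UNIV 0] by (simp add: supported_on_def)

lemma subspace_dual_on:
  "fn.subspace (dual_on V)"
  unfolding fn.subspace_def dual_on_def supported_on_def
  by (auto simp: algebra_simps)

lemma subspace_quad_on: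
  fixes V :: "('b \<Rightarrow> 'a::field) set"
  assumes "fn.subspace V"
  shows "fn.subspace (quad_on V)"
proof (rule fn.subspaceI)
  have D: "cut_to V (\<lambda>x. f (x + y) + g (x + y) - (f x + g x) - (f y + g y)) =
      cut_to V (\<lambda>x. f (x + y) - f x - f y) + cut_to V (\<lambda>x. g (x + y) - g x - g y)"
    for f g :: "('b \<Rightarrow> 'a) \<Rightarrow> 'a" and y
    by (auto simp: cut_to_def fun_eq_iff algebra_simps)
  have S: "cut_to V (\<lambda>x. c * f (x + y) - c * f x - c * f y) =
      scl c (cut_to V (\<lambda>x. f (x + y) - f x - f y))"
    for c and f :: "('b \<Rightarrow> 'a) \<Rightarrow> 'a" and y
    by (auto simp: cut_to_def fun_eq_iff algebra_simps)
  have Z: "cut_to V (\<lambda>x. 0) = (0 :: ('b \<Rightarrow> 'a) \<Rightarrow> 'a)"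
    by (auto simp: cut_to_def)
  show "0 \<in> quad_on V"
    using fn.subspace_0[OF subspace_dual_on[of V]]
    by (auto simp: quad_on_def supported_on_def Z)
  show "f + g \<in> quad_on V" if "f \<in> quad_on V" "g \<in> quad_on V" for f g
    using that fn.subspace_add[OF subspace_dual_on[of V]]
    by (auto simp: quad_on_def D supported_on_def distrib_left)
  show "scl c f \<in> quad_on V" if "f \<in> quad_on V" for c f
    using that fn.subspace_scale[OF subspace_dual_on[of V]]
    by (auto simp: quad_on_def S supported_on_def mult.left_commute)
qed

lemma cut_to_dual_on:
  assumes "fn.subspace H" "H \<subseteq> V" "f \<in> dual_on V"
  shows "cut_to H f \<in> dual_on H"
  using assms fn.subspace_add[OF assms(1)] fn.subspace_scale[OF assms(1)]
  unfolding dual_on_def supported_on_def cut_to_def by (auto simp: subset_iff)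

lemma cut_to_quad_on:
  assumes "fn.subspace H" "H \<subseteq> V" "f \<in> quad_on V"
  shows "cut_to H f \<in> quad_on H"
proof -
  have "cut_to H (\<lambda>x. cut_to H f (x + y) - cut_to H f x - cut_to H f y) \<in> dual_on H"
    if "y \<in> H" for y
  proof -
    have "cut_to V (\<lambda>x. f (x + y) - f x - f y) \<in> dual_on V"
      using assms that by (auto simp: quad_on_def)
    moreover have "cut_to H (\<lambda>x. cut_to H f (x + y) - cut_to H f x - cut_to H f y) =
        cut_to H (cut_to V (\<lambda>x. f (x + y) - f x - f y))"
      using assms(2) that fn.subspace_add[OF assms(1)] by (auto simp: cut_to_def fun_eq_iff)
    ultimately show ?thesis
      using cut_to_dual_on[OF assms(1,2)] by simp
  qed
  then show ?thesis
    using assms fn.subspace_scale[OF assms(1)]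
    unfolding quad_on_def supported_on_def by (auto simp: cut_to_def subset_iff)
qed

text \<open>
  The nonempty fibres of an additive map are translates of its kernel.
\<close>
lemma card_eq_image_times_kernel:
  fixes \<phi> :: "'b::ab_group_add \<Rightarrow> 'c::ab_group_add"
  assumes fin: "finite A"
    and sub: "\<And>x y. x \<in> A \<Longrightarrow> y \<in> A \<Longrightarrow> x - y \<in> A"
    and add: "\<And>x y. x \<in> A \<Longrightarrow> y \<in> A \<Longrightarrow> x + y \<in> A"
    and hom: "\<And>x y. x \<in> A \<Longrightarrow> y \<in> A \<Longrightarrow> \<phi> (x + y) = \<phi> x + \<phi> y"
  shows "card A = card (\<phi> ` A) * card {x \<in> A. \<phi> x = 0}"
proof -
  have homd: "\<phi> (x - y) = \<phi> x - \<phi> y" if "x \<in> A" "y \<in> A" for x y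
    using hom[OF sub[OF that] that(2)] by simp
  have "card {x \<in> A. \<phi> x = y} = card {x \<in> A. \<phi> x = 0}" if y: "y \<in> \<phi> ` A" for y
  proof -
    from y obtain e where e: "e \<in> A" "\<phi> e = y" by auto
    have "bij_betw (\<lambda>x. x - e) {x \<in> A. \<phi> x = y} {x \<in> A. \<phi> x = 0}"
      by (rule bij_betwI[where g = "\<lambda>x. x + e"]) (auto simp: e sub add hom homd)
    then show ?thesis by (rule bij_betw_same_card)
  qed
  then have "(\<Sum>y\<in>\<phi> ` A. card {x \<in> A. \<phi> x = y}) = card (\<phi> ` A) * card {x \<in> A. \<phi> x = 0}"
    by simp
  moreover have "(\<Sum>y\<in>\<phi> ` A. card {x \<in> A. \<phi> x = y}) = card A"
    using sum.group[of A "\<phi> ` A" \<phi> "\<lambda>_. 1 :: nat"] fin by simp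
  ultimately show ?thesis by simp
qed

text \<open>
  A nonzero linear functional takes every value. It is used for functionals on spaces of vectors and
  also, with \<open>\<phi>\<close> evaluation at a point, on spaces of forms.
\<close>
lemma card_kernel_functional:
  fixes A :: "('i \<Rightarrow> 'a::{field,finite}) set" and \<phi> :: "('i \<Rightarrow> 'a) \<Rightarrow> 'a"
  assumes fin: "finite A" and A: "fn.subspace A"
    and add: "\<And>x y. x \<in> A \<Longrightarrow> y \<in> A \<Longrightarrow> \<phi> (x + y) = \<phi> x + \<phi> y"
    and scale: "\<And>c x. x \<in> A \<Longrightarrow> \<phi> (scl c x) = c * \<phi> x"
    and nz: "x \<in> A" "\<phi> x \<noteq> 0"
  shows "CARD('a) * card {x \<in> A. \<phi> x = 0} = card A"
proof -
  have "y \<in> \<phi> ` A" for y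
    using scale[OF nz(1), of "y / \<phi> x"] nz fn.subspace_scale[OF A nz(1)]
    by (metis (no_types) image_eqI nonzero_eq_divide_eq)
  then have "\<phi> ` A = UNIV" by auto
  then show ?thesis
    using card_eq_image_times_kernel[of A \<phi>] fin add fn.subspace_diff[OF A] fn.subspace_add[OF A]
    by simp
qed

lemma subspace_kernel:
  assumes "fn.subspace A"
    and "\<And>x y. x \<in> A \<Longrightarrow> y \<in> A \<Longrightarrow> \<phi> (x + y) = \<phi> x + \<phi> y"
    and "\<And>c x. x \<in> A \<Longrightarrow> \<phi> (scl c x) = c * \<phi> x"
  shows "fn.subspace {x \<in> A. \<phi> x = (0::'a::field)}"
proof (rule fn.subspaceI)
  show "0 \<in> {x \<in> A. \<phi> x = 0}"
    using assms(3)[of 0 0] fn.subspace_0[OF assms(1)] by (simp add: scl_def zero_fun_def)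
qed (use assms fn.subspace_add[OF assms(1)] fn.subspace_scale[OF assms(1)] in auto)

text \<open>
  As long as some coordinate does not vanish identically, its kernel is a subspace that is smaller by
  the factor \<open>CARD('a)\<close>.
\<close>
lemma card_subspace_power:
  fixes A :: "('i \<Rightarrow> 'a::{field,finite}) set"
  assumes "finite A" "fn.subspace A"
  shows "\<exists>k. card A = CARD('a) ^ k"
  using assms
proof (induction "card A" arbitrary: A rule: less_induct)
  case less
  show ?case
  proof (cases "A \<subseteq> {0}")
    case True
    then have "A = {0}" using fn.subspace_0[OF less(3)] by auto
    then show ?thesis by (auto intro: exI[of _ 0])
  next
    case False
    then obtain f i where fi: "f \<in> A" "f i \<noteq> 0" by (auto simp: zero_fun_def fun_eq_iff)
    let ?K = "{g \<in> A. g i = 0}"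
    have "?K \<subset> A" using fi by auto
    then have "card ?K < card A" using less(2) psubset_card_mono by blast
    moreover have "fn.subspace ?K" by (rule subspace_kernel) (use less in auto)
    ultimately obtain k where "card ?K = CARD('a) ^ k"
      using less(1)[of ?K] finite_subset[OF _ less(2), of ?K] by blast
    moreover have "CARD('a) * card ?K = card A"
      by (rule card_kernel_functional[where x = f]) (use less fi in auto)
    ultimately have "card A = CARD('a) ^ Suc k" by simp
    then show ?thesis ..
  qed
qed

lemma two_le_card_field: "2 \<le> CARD('a::{field,finite})"
  using card_mono[of UNIV "{0, 1 :: 'a}"] by simp

lemma sum_card_zeros_swap:
  assumes "finite L" "finite V"
  shows "(\<Sum>f\<in>L. card {x \<in> V. f x = 0}) = (\<Sum>x\<in>V. card {f \<in> L. f x = (0::'a::zero)})"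
proof -
  have "(\<Sum>f\<in>L. card {x \<in> V. f x = 0}) = (\<Sum>f\<in>L. \<Sum>x\<in>V. if f x = 0 then 1 else 0)"
    using assms by (simp add: sum.If_cases Int_def)
  also have "\<dots> = (\<Sum>x\<in>V. \<Sum>f\<in>L. if f x = 0 then 1 else 0)"
    by (rule sum.swap)
  finally show ?thesis using assms by (simp add: sum.If_cases Int_def)
qed

lemma dual_onD:
  assumes "f \<in> dual_on V" 
  shows "x \<in> V \<Longrightarrow> y \<in> V \<Longrightarrow> f (x + y) = f x + f y"
    and "x \<in> V \<Longrightarrow> f (scl c x) = c * f x"
    and "x \<notin> V \<Longrightarrow> f x = 0"
  using assms by (auto simp: dual_on_def supported_on_def)

lemma dual_on_supported: "dual_on V \<subseteq> supported_on V"
  by (auto simp: dual_on_def)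

lemma card_kernel_dual:
  fixes V :: "('i \<Rightarrow> 'a::{field,finite}) set"
  assumes "finite V" "fn.subspace V" "f \<in> dual_on V" "f \<noteq> 0"
  shows "CARD('a) * card {x \<in> V. f x = 0} = card V"
proof -
  obtain x where "f x \<noteq> 0" using assms(4) by (auto simp: fun_eq_iff)
  moreover have "x \<in> V" using calculation dual_onD(3)[OF assms(3)] by auto
  ultimately show ?thesis
    by (intro card_kernel_functional) (use assms dual_onD[OF assms(3)] in auto)
qed

text \<open>
  This is the dimension formula \<open>dim L + dim (annihilator of L) = dim V\<close>. Counting the pairs
  \<open>(f, x)\<close> with \<open>f x = 0\<close> in two ways replaces a choice of bases. A nonzero \<open>f\<close> vanishes on exactly one
  \<open>q\<close>th of \<open>V\<close>, a point outside the annihilator is killed by exactly one \<open>q\<close>th of \<open>L\<close>, and the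
  resulting equation can be solved for the size of the annihilator.
\<close>
lemma card_annihilator:
  fixes V :: "('i \<Rightarrow> 'a::{field,finite}) set"
  assumes fin: "finite V" and V: "fn.subspace V" and L: "fn.subspace L" "L \<subseteq> dual_on V"
  shows "card {x \<in> V. \<forall>f\<in>L. f x = 0} * card L = card V"
proof -
  let ?S = "{x \<in> V. \<forall>f\<in>L. f x = 0}"
  define q v l s where "q = int CARD('a)" and "v = int (card V)" and "l = int (card L)"
    and "s = int (card ?S)"
  have finL: "finite L"
    using L(2) finite_supported_on[OF fin] dual_on_supported by (metis finite_subset)
  have z: "0 \<in> L" using fn.subspace_0[OF L(1)] .
  \<comment> \<open>Double counting, first for fixed \<open>f\<close> and then for fixed \<open>x\<close>.\<close>
  have c0: "q * int (card {x \<in> V. f x = 0}) = v" if "f \<in> L - {0}" for f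
    using card_kernel_dual[OF fin V, of f] L(2) that unfolding q_def v_def
    by (metis (no_types, lifting) DiffE insertI1 of_nat_mult subsetD)
  have cL: "int (card (L - {0})) = l - 1"
    using finL z card_Suc_Diff1[OF finL z] by (simp add: l_def)
  have c1: "q * int (card {f \<in> L. f x = 0}) = l" if x: "x \<in> V - ?S" for x
  proof -
    from x obtain f where "f \<in> L" "f x \<noteq> 0" by auto
    then have "CARD('a) * card {f \<in> L. f x = 0} = card L"
      by (intro card_kernel_functional[OF finL L(1)]) auto
    then show ?thesis by (simp add: q_def l_def flip: of_nat_mult)
  qed
  have "q * (\<Sum>f\<in>L. int (card {x \<in> V. f x = 0})) =
      q * int (card {x \<in> V. (0 :: _ \<Rightarrow> 'a) x = 0}) + (\<Sum>f\<in>L - {0}. q * int (card {x \<in> V. f x = 0}))"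
    by (subst sum.remove[OF finL z]) (simp add: algebra_simps sum_distrib_left)
  also have "\<dots> = q * v + (l - 1) * v"
    using c0 cL by (simp add: v_def)
  finally have e1: "q * (\<Sum>f\<in>L. int (card {x \<in> V. f x = 0})) = q * v + (l - 1) * v" .
  have "q * (\<Sum>x\<in>V. int (card {f \<in> L. f x = 0})) =
      (\<Sum>x\<in>V - ?S. q * int (card {f \<in> L. f x = 0})) + (\<Sum>x\<in>?S. q * int (card {f \<in> L. f x = 0}))"
    using fin by (subst sum.subset_diff[of ?S V]) (auto simp: algebra_simps sum_distrib_left)
  also have "(\<Sum>x\<in>V - ?S. q * int (card {f \<in> L. f x = 0})) = int (card (V - ?S)) * l"
    using c1 by simp
  also have "int (card (V - ?S)) = v - s"
    using fin by (subst card_Diff_subset) (auto simp: v_def s_def of_nat_diff card_mono)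
  also have "(\<Sum>x\<in>?S. q * int (card {f \<in> L. f x = 0})) = (\<Sum>x\<in>?S. q * l)"
    unfolding l_def by (rule sum.cong[OF refl], rule arg_cong[where f = "\<lambda>A. q * int (card A)"]) auto
  finally have e2: "q * (\<Sum>x\<in>V. int (card {f \<in> L. f x = 0})) = (v - s) * l + s * (q * l)"
    by (simp add: s_def)
  have "(\<Sum>f\<in>L. int (card {x \<in> V. f x = 0})) = (\<Sum>x\<in>V. int (card {f \<in> L. f x = 0}))"
    using sum_card_zeros_swap[OF finL fin] by (simp flip: of_nat_sum)
  with e1 e2 have "(q - 1) * v = (q - 1) * (s * l)"
    by (simp add: algebra_simps)
  moreover have "q \<noteq> 1" using two_le_card_field[where 'a = 'a] by (simp add: q_def)
  ultimately have "v = s * l" by simp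
  then show ?thesis by (simp add: v_def s_def l_def flip: of_nat_mult)
qed

lemma dual_on_separates:
  assumes "x \<in> V" "x \<noteq> 0" and V: "fn.subspace V"
  shows "\<exists>f\<in>dual_on V. f x \<noteq> 0"
proof -
  obtain i where "x i \<noteq> 0" using assms(2) by (auto simp: fun_eq_iff)
  moreover have "cut_to V (\<lambda>y. y i) \<in> dual_on V"
    using fn.subspace_add[OF V] fn.subspace_scale[OF V]
    by (auto simp: dual_on_def supported_on_def cut_to_def)
  ultimately show ?thesis using assms(1) by (intro bexI) (auto simp: cut_to_def)
qed

lemma card_dual_on:
  fixes V :: "('i \<Rightarrow> 'a::{field,finite}) set"
  assumes "finite V" and V: "fn.subspace V"
  shows "card (dual_on V) = card V"
proof -
  have "f 0 = 0" if "f \<in> dual_on V" for f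
    using dual_onD(2)[OF that fn.subspace_0[OF V], of 0] by (simp add: scl_def zero_fun_def)
  then have "{x \<in> V. \<forall>f\<in>dual_on V. f x = 0} = {0}"
    using dual_on_separates[OF _ _ V] fn.subspace_0[OF V] by auto
  then show ?thesis using card_annihilator[OF assms subspace_dual_on order_refl] by simp
qed


section \<open>Quadratic forms and hyperplanes\<close>

lemma singleton_if_card_1:
  assumes "card A = 1" "x \<in> A"
  shows "A = {x}"
  using assms by (auto simp: card_1_singleton_iff)

lemma quad_onD:
  assumes "f \<in> quad_on V"
  shows "x \<in> V \<Longrightarrow> f (scl c x) = c\<^sup>2 * f x"
    and "y \<in> V \<Longrightarrow> cut_to V (\<lambda>x. f (x + y) - f x - f y) \<in> dual_on V"
    and "x \<notin> V \<Longrightarrow> f x = 0"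
  using assms by (auto simp: quad_on_def supported_on_def)

lemma quad_on_supported: "quad_on V \<subseteq> supported_on V"
  by (auto simp: quad_on_def)

text \<open>
  The slice \<open>l = 1\<close> is a translate \<open>e + H\<close> of \<open>H = ker l\<close>. If \<open>e\<close> is a common zero of \<open>U\<close>, then
  \<open>f (h + e)\<close> with \<open>h \<in> H\<close> is the value of the polarization of \<open>f\<close> at \<open>(h, e)\<close>, which is linear in \<open>h\<close>.
  So the common zeros on the slice correspond to the annihilator of a space of linear forms on \<open>H\<close>, and
  this space is as large as \<open>U\<close> because a form vanishing on \<open>H\<close> and on the slice is zero. (For
  \<open>f = l l'\<close> the linear form is the restriction of \<open>l'\<close> to \<open>H\<close>.)
\<close>
lemma card_slice_times_card_le:
  fixes V :: "('i \<Rightarrow> 'a::{field,finite}) set"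
  assumes fin: "finite V" and V: "fn.subspace V" and l: "l \<in> dual_on V"
    and U: "fn.subspace U" "U \<subseteq> quad_on V"
    and van: "\<And>f x. f \<in> U \<Longrightarrow> x \<in> V \<Longrightarrow> l x = 0 \<Longrightarrow> f x = 0"
  shows "card {x \<in> V. l x = 1 \<and> (\<forall>f\<in>U. f x = 0)} * card U \<le> card {x \<in> V. l x = 0}"
proof (cases "{x \<in> V. l x = 1 \<and> (\<forall>f\<in>U. f x = 0)} = {}")
  case False
  let ?S = "{x \<in> V. l x = 1 \<and> (\<forall>f\<in>U. f x = 0)}" and ?H = "{x \<in> V. l x = 0}"
  from False obtain e where e: "e \<in> V" "l e = 1" "\<And>f. f \<in> U \<Longrightarrow> f e = 0" by auto
  have H: "fn.subspace ?H"
    by (rule subspace_kernel[OF V]) (use dual_onD[OF l] in auto)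
  have finH: "finite ?H" using fin by simp
  define T where "T f = cut_to ?H (\<lambda>h. f (h + e))" for f :: "('i \<Rightarrow> 'a) \<Rightarrow> 'a"
  have T_eq: "T f = cut_to ?H (cut_to V (\<lambda>h. f (h + e) - f h - f e))" if "f \<in> U" for f
    using van[OF that] e(3)[OF that] e(1) fn.subspace_add[OF V]
    by (auto simp: T_def cut_to_def fun_eq_iff)
  have TD: "T ` U \<subseteq> dual_on ?H"
  proof
    fix g assume "g \<in> T ` U"
    then obtain f where f: "f \<in> U" "g = T f" by auto
    show "g \<in> dual_on ?H"
      unfolding f(2) T_eq[OF f(1)]
      by (rule cut_to_dual_on[OF H, of V]) (use f U(2) quad_onD(2) e in auto)
  qed
  have Tadd: "T (f + g) = T f + T g" for f g
    by (auto simp: T_def cut_to_def)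
  have Tscl: "T (scl c f) = scl c (T f)" for c f
    by (auto simp: T_def cut_to_def)
  have T0: "T 0 = 0"
    by (auto simp: T_def cut_to_def)
  have TS: "fn.subspace (T ` U)"
  proof (rule fn.subspaceI)
    show "0 \<in> T ` U" using fn.subspace_0[OF U(1)] T0 by (metis imageI)
  next
    fix x y assume "x \<in> T ` U" "y \<in> T ` U"
    then show "x + y \<in> T ` U" using fn.subspace_add[OF U(1)] by (auto simp flip: Tadd)
  next
    fix c x assume "x \<in> T ` U"
    then show "scl c x \<in> T ` U" using fn.subspace_scale[OF U(1)] by (auto simp flip: Tscl)
  qed
  \<comment> \<open>Any point off \<open>?H\<close> is a scalar multiple of a point of the slice.\<close>
  have inj: "f = 0" if f: "f \<in> U" and Tf: "T f = 0" for f
  proof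
    fix x
    show "f x = 0 x"
    proof (cases "x \<in> V \<and> l x \<noteq> 0")
      case True
      define h where "h = scl (inverse (l x)) x - e"
      have "h \<in> ?H"
        using True e fn.subspace_scale[OF V] fn.subspace_diff[OF V] dual_onD(2)[OF l]
          dual_onD(1)[OF l, of h e] by (auto simp: h_def)
      then have "f (h + e) = 0"
        using fun_cong[OF Tf, of h] by (simp add: T_def cut_to_def)
      then have "f (scl (inverse (l x)) x) = 0" by (simp add: h_def)
      moreover have "f (scl (inverse (l x)) x) = (inverse (l x))\<^sup>2 * f x"
        using f U(2) True quad_onD(1) by blast
      ultimately show ?thesis using True by simp
    next
      case False
      then show ?thesis using van[OF f] quad_onD(3)[of f V x] U(2) f by auto
    qed
  qed
  have finU: "finite U"
    using U(2) finite_supported_on[OF fin] quad_on_supported by (metis finite_subset)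
  have "{f \<in> U. T f = 0} = {0}" using inj T0 fn.subspace_0[OF U(1)] by auto
  then have cT: "card (T ` U) = card U"
    using card_eq_image_times_kernel[OF finU, of T] fn.subspace_add[OF U(1)]
      fn.subspace_diff[OF U(1)] Tadd by simp
  have S_le: "card ?S \<le> card {h \<in> ?H. \<forall>g\<in>T ` U. g h = 0}"
  proof (rule card_inj_on_le)
    show "inj_on (\<lambda>x. x - e) ?S" by (auto simp: inj_on_def)
    show "(\<lambda>x. x - e) ` ?S \<subseteq> {h \<in> ?H. \<forall>g\<in>T ` U. g h = 0}"
    proof
      fix h assume "h \<in> (\<lambda>x. x - e) ` ?S"
      then obtain x where x: "x \<in> V" "l x = 1" "\<And>f. f \<in> U \<Longrightarrow> f x = 0" "h = x - e" by auto
      have "h \<in> V" using x e fn.subspace_diff[OF V] by auto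
      moreover have "l h = 0"
        using dual_onD(1)[OF l \<open>h \<in> V\<close> e(1)] x e by simp
      ultimately show "h \<in> {h \<in> ?H. \<forall>g\<in>T ` U. g h = 0}"
        using x by (auto simp: T_def cut_to_def)
    qed
    show "finite {h \<in> ?H. \<forall>g\<in>T ` U. g h = 0}"
      by (rule finite_subset[OF _ finH]) auto
  qed
  then show ?thesis
    using card_annihilator[OF finH H TS TD] mult_le_mono1[OF S_le, of "card U"]
    unfolding cT by linarith
next
  case True
  then show ?thesis unfolding True by simp
qed

text \<open>
  A zero off the hyperplane can be scaled to one with \<open>l x = 1\<close>, in such a way that \<open>CARD('a) - 1\<close> zeros
  have the same image.
\<close>
lemma card_zeros_le_slice:
  fixes V :: "('i \<Rightarrow> 'a::{field,finite}) set"
  assumes fin: "finite V" and V: "fn.subspace V" and l: "l \<in> dual_on V"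
    and W: "W \<subseteq> quad_on V" and U: "U \<subseteq> W"
  shows "card {x \<in> V. \<forall>f\<in>W. f x = 0} \<le> card {x \<in> V. l x = 0 \<and> (\<forall>f\<in>W. f x = 0)}
    + (CARD('a) - 1) * card {x \<in> V. l x = 1 \<and> (\<forall>f\<in>U. f x = 0)}"
proof -
  let ?X = "{x \<in> V. \<forall>f\<in>W. f x = 0}" and ?S = "{x \<in> V. l x = 1 \<and> (\<forall>f\<in>U. f x = 0)}"
  let ?H = "{x \<in> V. l x = 0 \<and> (\<forall>f\<in>W. f x = 0)}"
  let ?I = "(\<lambda>(c, x). scl c x) ` ((UNIV - {0}) \<times> ?S)"
  have "?X \<subseteq> ?H \<union> ?I"
  proof
    fix x assume x: "x \<in> ?X"
    show "x \<in> ?H \<union> ?I"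
    proof (cases "l x = 0")
      case True
      then show ?thesis using x by simp
    next
      case False
      let ?y = "scl (inverse (l x)) x"
      have "x = scl (l x) ?y" using False by (auto simp: fun_eq_iff)
      moreover have "f ?y = 0" if "f \<in> U" for f
        using that x quad_onD(1)[of f V x "inverse (l x)"] subsetD[OF W, of f] subsetD[OF U, of f]
        by auto
      then have "?y \<in> ?S"
        using x False fn.subspace_scale[OF V] dual_onD(2)[OF l] by auto
      ultimately have "x = (\<lambda>(c, x). scl c x) (l x, ?y)" "(l x, ?y) \<in> (UNIV - {0}) \<times> ?S"
        using False by auto
      then show ?thesis by blast
    qed
  qed
  then have "card ?X \<le> card (?H \<union> ?I)"
    by (rule card_mono[rotated]) (use fin in simp)
  also have "\<dots> \<le> card ?H + card ?I" by (rule card_Un_le)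
  also have "card ?I \<le> card ((UNIV - {0 :: 'a}) \<times> ?S)"
    by (rule card_image_le) (use fin in simp)
  finally show ?thesis by (simp add: card_cartesian_product card_Diff_singleton)
qed

text \<open>
  Count the pairs of a functional \<open>l \<noteq> 0\<close> and a point \<open>x \<in> X\<close> with \<open>l x = 0\<close>. Every \<open>x \<noteq> 0\<close> lies in
  \<open>q\<^sup>k - 1\<close> of the kernels and \<open>0\<close> lies in all \<open>q\<^bsup>k+1\<^esup> - 1\<close> of them. Removing the contribution of the
  origin from both sides gives the form stated.
\<close>
lemma average_over_hyperplanes:
  fixes V :: "('i \<Rightarrow> 'a::{field,finite}) set"
  assumes fin: "finite V" and V: "fn.subspace V" and cV: "card V = CARD('a) ^ Suc k"
    and X: "X \<subseteq> V" "0 \<in> X"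
    and le: "\<And>l. l \<in> dual_on V \<Longrightarrow> l \<noteq> 0 \<Longrightarrow> card {x \<in> X. l x = 0} \<le> b"
  shows "(int (card X) - 1) * (int CARD('a) ^ k - 1) \<le> (int CARD('a) ^ Suc k - 1) * (int b - 1)"
proof -
  let ?L = "dual_on V"
  have finX: "finite X" using fin X finite_subset by auto
  have finL: "finite ?L"
    using finite_supported_on[OF fin] dual_on_supported by (metis finite_subset)
  have zL: "0 \<in> ?L" by (rule fn.subspace_0[OF subspace_dual_on])
  have cL: "int (card ?L) = int CARD('a) ^ Suc k"
    using card_dual_on[OF fin V] cV by simp
  have "f 0 = 0" if "f \<in> ?L" for f
    using dual_onD(2)[OF that fn.subspace_0[OF V], of 0] by (simp add: scl_def zero_fun_def)
  then have K0: "{f \<in> ?L. f 0 = 0} = ?L" by auto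
  have K: "card {f \<in> ?L. f x = 0} = CARD('a) ^ k" if x: "x \<in> X - {0}" for x
  proof -
    obtain f where "f \<in> ?L" "f x \<noteq> 0" using dual_on_separates[of x V] V x X(1) by blast
    then have "CARD('a) * card {f \<in> ?L. f x = 0} = card ?L"
      by (intro card_kernel_functional[OF finL subspace_dual_on]) auto
    then show ?thesis using card_dual_on[OF fin V] cV two_le_card_field[where 'a = 'a] by simp
  qed
  have cL1: "int (card (?L - {0})) = int CARD('a) ^ Suc k - 1"
    using card_Suc_Diff1[OF finL zL] cL by linarith
  have cX1: "int (card (X - {0})) = int (card X) - 1"
    using card_Suc_Diff1[OF finX X(2)] by linarith
  have "(\<Sum>f\<in>?L. int (card {x \<in> X. f x = 0})) = (\<Sum>x\<in>X. int (card {f \<in> ?L. f x = 0}))"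
    using sum_card_zeros_swap[OF finL finX] by (simp flip: of_nat_sum)
  moreover have "(\<Sum>x\<in>X. int (card {f \<in> ?L. f x = 0}))
      = int CARD('a) ^ Suc k + (int (card X) - 1) * int CARD('a) ^ k"
    using K0 K cL cX1 by (simp add: sum.remove[OF finX X(2)])
  moreover have "(\<Sum>f\<in>?L. int (card {x \<in> X. f x = 0}))
      = int (card X) + (\<Sum>f\<in>?L - {0}. int (card {x \<in> X. f x = 0}))"
    by (simp add: sum.remove[OF finL zL])
  moreover have "(\<Sum>f\<in>?L - {0}. int (card {x \<in> X. f x = 0})) \<le> (\<Sum>f\<in>?L - {0}. int b)"
    by (rule sum_mono) (use le in auto)
  moreover have "(\<Sum>f\<in>?L - {0}. int b) = (int CARD('a) ^ Suc k - 1) * int b"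
    using cL1 by simp
  ultimately have "int CARD('a) ^ Suc k + (int (card X) - 1) * int CARD('a) ^ k
      \<le> int (card X) + (int CARD('a) ^ Suc k - 1) * int b"
    by linarith
  then show ?thesis by (simp add: algebra_simps)
qed

section \<open>The bound for common zeros of quadratic forms\<close>

text \<open>
  The affine count for \<open>r\<close> forms in \<open>n\<close> variables. For \<open>r < n\<close> it is the number of zeros of
  \<open>x\<^sub>0 x\<^sub>1, \<dots>, x\<^sub>0 x\<^sub>r\<close>, for \<open>r = n\<close> it is the size of a hyperplane.
\<close>
definition quad_bound :: "nat \<Rightarrow> nat \<Rightarrow> nat \<Rightarrow> nat" where
  "quad_bound q n r = q ^ (n - 1) + (if r < n then (q - 1) * q ^ (n - 1 - r) else 0)"

text \<open>
  Convexity of the exponential: among two powers with a given sum of exponents, spreading the exponents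
  increases the sum. The inequality is \<open>0 \<le> q\<^sup>b (q\<^sup>c - 1) (q\<^sup>s - 1)\<close>.
\<close>
lemma power_sum_le_spread:
  fixes q :: nat
  assumes "2 \<le> q"
  shows "q ^ (b + s) + q ^ (b + c) \<le> q ^ (b + c + s) + q ^ b"
proof -
  have "0 \<le> (int q ^ c - 1) * (int q ^ s - 1)"
    using assms by (intro mult_nonneg_nonneg) auto
  then have "0 \<le> int q ^ b * ((int q ^ c - 1) * (int q ^ s - 1))"
    by simp
  then have "int (q ^ (b + s) + q ^ (b + c)) \<le> int (q ^ (b + c + s) + q ^ b)"
    by (simp add: algebra_simps power_add)
  then show ?thesis by (simp only: of_nat_le_iff)
qed

text \<open>
  After \<open>q\<^bsup>k-1\<^esup>\<close> and the factor \<open>q - 1\<close> are taken out, the claim compares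
  \<open>q\<^bsup>k-1-r+a\<^esup> + q\<^bsup>k-a\<^esup>\<close> with \<open>q\<^bsup>k-1\<^esup> + q\<^bsup>k-r\<^esup>\<close>. The exponents have the same sum, and those on
  the right are further apart. If \<open>r = k + 1\<close>, the last power is missing on the right; this is compensated by
  the room between \<open>q\<^bsup>a-2\<^esup> + 1\<close> and \<open>q\<^bsup>a-1\<^esup>\<close>, and for \<open>a = 1\<close> the first power is missing as well.
\<close>
lemma quad_bound_split:
  fixes q k r a t :: nat
  assumes q: "2 \<le> q" and a: "1 \<le> a" "a < r" "r \<le> Suc k" and t: "t \<le> q ^ (k - a)"
  shows "quad_bound q k (r - a) + (q - 1) * t \<le> quad_bound q (Suc k) r"
proof -
  have core: "(if r - a < k then q ^ (k - 1 - (r - a)) else 0) + q ^ (k - a)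
      \<le> q ^ (k - 1) + (if r \<le> k then q ^ (k - r) else 0)"
  proof (cases "r \<le> k")
    case True
    have "q ^ (k - r + (a - 1)) + q ^ (k - r + (r - a)) \<le> q ^ (k - r + (r - a) + (a - 1)) + q ^ (k - r)"
      by (rule power_sum_le_spread[OF q])
    moreover have "k - r + (a - 1) = k - 1 - (r - a)" "k - r + (r - a) = k - a"
      "k - r + (r - a) + (a - 1) = k - 1"
      using True a by auto
    ultimately show ?thesis using True a by simp
  next
    case False
    then have r: "r = Suc k" using a by simp
    show ?thesis
    proof (cases "a = 1")
      case True
      then show ?thesis using r by simp
    next
      case False
      have "q ^ (0 + (k - a)) + q ^ (0 + (a - 1)) \<le> q ^ (0 + (a - 1) + (k - a)) + q ^ 0"
        by (rule power_sum_le_spread[OF q])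
      moreover have "a - 1 + (k - a) = k - 1" using a r by simp
      moreover have "2 * q ^ (a - 2) \<le> q ^ (a - 1)"
      proof -
        have "a - 1 = Suc (a - 2)" using False a by simp
        then show ?thesis using q by simp
      qed
      moreover have "1 \<le> q ^ (a - 2)" using q by simp
      moreover have e: "k - 1 - (r - a) = a - 2" using a r False by simp
      ultimately show ?thesis unfolding e using r by simp
    qed
  qed
  have "quad_bound q k (r - a) + (q - 1) * t
      \<le> q ^ (k - 1) + (q - 1) * ((if r - a < k then q ^ (k - 1 - (r - a)) else 0) + q ^ (k - a))"
    using t by (auto simp: quad_bound_def distrib_left)
  also have "\<dots> \<le> q ^ (k - 1) + (q - 1) * (q ^ (k - 1) + (if r \<le> k then q ^ (k - r) else 0))"
    using core by simp
  also have "\<dots> = quad_bound q (Suc k) r"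
  proof -
    have "k = Suc (k - 1)" using a by simp
    then have "q ^ k = q * q ^ (k - 1)" by (metis power_Suc)
    then have "q ^ (k - 1) + (q - 1) * q ^ (k - 1) = q ^ k"
      using q by (simp add: algebra_simps)
    then show ?thesis by (auto simp: quad_bound_def distrib_left)
  qed
  finally show ?thesis .
qed

text \<open>
  With \<open>B\<close> the bound on hyperplanes and \<open>T\<close> the bound to be shown, it suffices that
  \<open>(q\<^bsup>k+1\<^esup> - 1) (B - 1) \<le> (T - 1) (q\<^sup>k - 1)\<close>. The difference of the two sides is a multiple of
  \<open>(q - 1)\<^sup>2\<close> that can be written down, up to a nonnegative term for \<open>r = k\<close>.
\<close>
lemma quad_bound_average:
  fixes q k r :: nat
  assumes q: "2 \<le> q" and k: "1 \<le> k" and r: "1 \<le> r" "r \<le> Suc k"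
    and N: "(N - 1) * (int q ^ k - 1) \<le> (int q ^ Suc k - 1) * (int (quad_bound q k (min r k)) - 1)"
  shows "N \<le> int (quad_bound q (Suc k) r)"
proof -
  define Q where "Q = int q"
  have Q: "Q \<ge> 2" using q by (simp add: Q_def)
  obtain k' where k': "k = Suc k'" using k by (cases k) auto
  have pos: "Q ^ k - 1 > 0" using Q k by simp
  have "(Q ^ Suc k - 1) * (int (quad_bound q k (min r k)) - 1)
      \<le> (int (quad_bound q (Suc k) r) - 1) * (Q ^ k - 1)"
  proof (cases "r < k")
    case True
    define s where "s = k' - r"
    have s: "k - 1 - r = s" "k - r = Suc s" using True k' by (auto simp: s_def)
    have b1: "int (quad_bound q k (min r k)) = Q ^ k' + (Q - 1) * Q ^ s"
      using True q s k' by (simp add: quad_bound_def Q_def of_nat_diff min_def)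
    have b2: "int (quad_bound q (Suc k) r) = Q ^ Suc k' + (Q - 1) * Q ^ Suc s"
      using True q s k' by (simp add: quad_bound_def Q_def of_nat_diff)
    have "(int (quad_bound q (Suc k) r) - 1) * (Q ^ k - 1)
        - (Q ^ Suc k - 1) * (int (quad_bound q k (min r k)) - 1)
        = (Q - 1)\<^sup>2 * (Q ^ k' - Q ^ s)"
      unfolding b1 b2 unfolding k' by (simp add: algebra_simps power2_eq_square)
    moreover have "Q ^ s \<le> Q ^ k'" using Q by (simp add: s_def power_increasing)
    ultimately show ?thesis
      by (metis diff_ge_0_iff_ge zero_le_mult_iff zero_le_power2)
  next
    case False
    have b1: "int (quad_bound q k (min r k)) = Q ^ k'"
      using False k' by (simp add: quad_bound_def Q_def min_def)
    have b2: "int (quad_bound q (Suc k) r) \<ge> Q ^ Suc k'"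
      using k' by (simp add: quad_bound_def Q_def)
    have "(Q ^ Suc k - 1) * (Q ^ k' - 1) + (Q - 1)\<^sup>2 * Q ^ k' = (Q ^ Suc k' - 1) * (Q ^ k - 1)"
      unfolding k' by (simp add: algebra_simps power2_eq_square)
    moreover have "0 \<le> (Q - 1)\<^sup>2 * Q ^ k'" using Q by simp
    moreover have "(Q ^ Suc k' - 1) * (Q ^ k - 1) \<le> (int (quad_bound q (Suc k) r) - 1) * (Q ^ k - 1)"
      using b2 pos by (intro mult_right_mono) auto
    ultimately show ?thesis unfolding b1 by linarith
  qed
  then have "(N - 1) * (Q ^ k - 1) \<le> (int (quad_bound q (Suc k) r) - 1) * (Q ^ k - 1)"
    using N by (simp add: Q_def)
  then show ?thesis using pos by (simp add: mult_le_cancel_right)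
qed

text \<open>
  The hypothesis on \<open>W\<close> is an inequality so that the induction may forget a part of \<open>W\<close>: on a
  hyperplane to which all of \<open>W\<close> restricts injectively, \<open>r = k + 1\<close> has to be replaced by \<open>k\<close>.
\<close>
lemma card_common_zeros_le:
  fixes V :: "('i \<Rightarrow> 'a::{field,finite}) set"
  assumes "finite V" "fn.subspace V" "card V = CARD('a) ^ n"
    and "fn.subspace W" "W \<subseteq> quad_on V" "CARD('a) ^ r \<le> card W" "1 \<le> r" "r \<le> n"
  shows "card {x \<in> V. \<forall>f\<in>W. f x = 0} \<le> quad_bound CARD('a) n r"
  using assms
proof (induction n arbitrary: V W r)
  case 0
  then show ?case by simp
next
  case (Suc k)
  note V = Suc.prems(1,2) and cV = Suc.prems(3) and W = Suc.prems(4,5) and cW = Suc.prems(6)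
  let ?q = "CARD('a)" and ?X = "{x \<in> V. \<forall>f\<in>W. f x = 0}"
  let ?ker = "\<lambda>l. {x \<in> V. l x = (0::'a)}"
  let ?U = "\<lambda>l. {f \<in> W. cut_to (?ker l) f = 0}"
  have q: "2 \<le> ?q" by (rule two_le_card_field)
  have finW: "finite W"
    using W(2) finite_supported_on[OF V(1)] quad_on_supported by (metis finite_subset)
  have cadd: "cut_to H (f + g) = cut_to H f + cut_to H g" for H and f g :: "('i \<Rightarrow> 'a) \<Rightarrow> 'a"
    by (auto simp: cut_to_def)
  have cscl: "cut_to H (scl c f) = scl c (cut_to H f)" for H c and f :: "('i \<Rightarrow> 'a) \<Rightarrow> 'a"
    by (auto simp: cut_to_def)
  have c0: "cut_to H (0 :: ('i \<Rightarrow> 'a) \<Rightarrow> 'a) = 0" for H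
    by (auto simp: cut_to_def)
  have H: "fn.subspace (?ker l)" if "l \<in> dual_on V" for l
    by (rule subspace_kernel[OF V(2)]) (use dual_onD[OF that] in auto)
  have cH: "card (?ker l) = ?q ^ k" if "l \<in> dual_on V" "l \<noteq> 0" for l
    using card_kernel_dual[OF V that] cV q by simp
  have U: "fn.subspace (?U l)" for l
  proof (rule fn.subspaceI)
    show "0 \<in> ?U l" using fn.subspace_0[OF W(1)] c0 by auto
  qed (use fn.subspace_add[OF W(1)] fn.subspace_scale[OF W(1)] cadd cscl in auto)
  \<comment> \<open>The dimension formula for the restriction map, whose kernel is \<open>?U l\<close>.\<close>
  have split: "card W = card (cut_to (?ker l) ` W) * card (?U l)" for l
    by (rule card_eq_image_times_kernel[OF finW])
      (use fn.subspace_add[OF W(1)] fn.subspace_diff[OF W(1)] cadd in auto)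
  have IH: "card {x \<in> V. l x = 0 \<and> (\<forall>f\<in>W. f x = 0)} \<le> quad_bound ?q k r'"
    if l: "l \<in> dual_on V" "l \<noteq> 0" and r': "?q ^ r' \<le> card (cut_to (?ker l) ` W)" "1 \<le> r'" "r' \<le> k"
    for l r'
  proof -
    have "fn.subspace (cut_to (?ker l) ` W)"
    proof (rule fn.subspaceI)
      show "0 \<in> cut_to (?ker l) ` W"
        by (rule image_eqI[OF _ fn.subspace_0[OF W(1)]]) (simp add: c0)
    next
      fix f g assume "f \<in> cut_to (?ker l) ` W" "g \<in> cut_to (?ker l) ` W"
      then show "f + g \<in> cut_to (?ker l) ` W"
        using fn.subspace_add[OF W(1)] by (auto simp flip: cadd)
    next
      fix c f assume "f \<in> cut_to (?ker l) ` W"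
      then show "scl c f \<in> cut_to (?ker l) ` W"
        using fn.subspace_scale[OF W(1)] by (auto simp flip: cscl)
    qed
    moreover have "cut_to (?ker l) ` W \<subseteq> quad_on (?ker l)"
      using cut_to_quad_on[OF H[OF l(1)], of V] W(2) by blast
    ultimately have "card {x \<in> ?ker l. \<forall>f\<in>cut_to (?ker l) ` W. f x = 0} \<le> quad_bound ?q k r'"
      by (rule Suc.IH[OF _ H[OF l(1)] cH[OF l] _ _ r', rotated]) (use V(1) in simp)
    moreover have "{x \<in> ?ker l. \<forall>f\<in>cut_to (?ker l) ` W. f x = 0}
        = {x \<in> V. l x = 0 \<and> (\<forall>f\<in>W. f x = 0)}"
      by (auto simp: cut_to_def)
    ultimately show ?thesis by simp
  qed
  show ?case
  proof (cases "\<exists>l\<in>dual_on V. l \<noteq> 0 \<and> ?U l \<noteq> {0}")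
    case True
    then obtain l where l: "l \<in> dual_on V" "l \<noteq> 0" and Ul: "?U l \<noteq> {0}" by auto
    obtain a where a: "card (?U l) = ?q ^ a"
      using card_subspace_power[OF _ U[of l]] finW by auto
    have a1: "1 \<le> a"
    proof (rule ccontr)
      assume "\<not> 1 \<le> a"
      then have "card (?U l) = 1" using a by simp
      then have "?U l = {0}" using fn.subspace_0[OF U] by (rule singleton_if_card_1)
      then show False using Ul by simp
    qed
    let ?S = "{x \<in> V. l x = 1 \<and> (\<forall>f\<in>?U l. f x = 0)}"
    have van: "f x = 0" if "f \<in> ?U l" "x \<in> V" "l x = 0" for f x
    proof -
      have "cut_to (?ker l) f = 0" using that(1) unfolding mem_Collect_eq ..
      then have "cut_to (?ker l) f x = 0" by simp
      then show ?thesis using that by (simp add: cut_to_def)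
    qed
    have "card ?S * card (?U l) \<le> card (?ker l)"
    proof (rule card_slice_times_card_le[OF V l(1) U[of l]])
      show "?U l \<subseteq> quad_on V" using W(2) by auto
    qed (fact van)
    then have S: "card ?S * ?q ^ a \<le> ?q ^ k" using a cH[OF l] by simp
    have S': "card ?S \<le> (if a \<le> k then ?q ^ (k - a) else 0)"
    proof (cases "a \<le> k")
      case True
      then have "?q ^ k = ?q ^ (k - a) * ?q ^ a" by (simp flip: power_add)
      then show ?thesis using S True q by simp
    next
      case False
      then have "?q ^ k < ?q ^ a" using q by (intro power_strict_increasing) auto
      then have "card ?S = 0" using S by (cases "card ?S") auto
      then show ?thesis using False by simp
    qed
    have X: "card ?X \<le> card {x \<in> V. l x = 0 \<and> (\<forall>f\<in>W. f x = 0)} + (?q - 1) * card ?S"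
      by (rule card_zeros_le_slice[OF V l(1) W(2)]) auto
    show ?thesis
    proof (cases "a < r")
      case True
      have "?q ^ (r - a) * ?q ^ a \<le> card (cut_to (?ker l) ` W) * ?q ^ a"
        using cW split[of l] a True by (simp flip: power_add)
      then have "?q ^ (r - a) \<le> card (cut_to (?ker l) ` W)" using q by simp
      then have "card {x \<in> V. l x = 0 \<and> (\<forall>f\<in>W. f x = 0)} \<le> quad_bound ?q k (r - a)"
        using IH[OF l] True a1 Suc.prems(8) by simp
      moreover have "card ?S \<le> ?q ^ (k - a)" using S' by (auto split: if_splits)
      ultimately show ?thesis
        using X quad_bound_split[OF q a1 True Suc.prems(8)] by (meson add_le_mono1 order_trans)
    next
      case False
      have "card {x \<in> V. l x = 0 \<and> (\<forall>f\<in>W. f x = 0)} \<le> card (?ker l)"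
        by (rule card_mono) (use V in auto)
      then have "card ?X \<le> ?q ^ k + (?q - 1) * card ?S" using X cH[OF l] by simp
      moreover have "?q ^ (k - a) \<le> ?q ^ (k - r)"
        using False q by (intro power_increasing) auto
      then have "card ?S \<le> (if r \<le> k then ?q ^ (k - r) else 0)"
        using S' False by (auto split: if_splits)
      then have "(?q - 1) * card ?S \<le> (if r \<le> k then (?q - 1) * ?q ^ (k - r) else 0)"
        by (auto split: if_splits)
      ultimately have "card ?X \<le> ?q ^ k + (if r \<le> k then (?q - 1) * ?q ^ (k - r) else 0)"
        by linarith
      then show ?thesis by (auto simp: quad_bound_def split: if_splits)
    qed
  next
    case False
    have cut: "card (cut_to (?ker l) ` W) = card W" if "l \<in> dual_on V" "l \<noteq> 0" for l
    proof -
      have "?U l = {0}" using False that by blast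
      then show ?thesis using split[of l] by simp
    qed
    obtain l where l: "l \<in> dual_on V" "l \<noteq> 0"
    proof -
      have "V \<noteq> {0}" using cV q by auto
      then obtain x where "x \<in> V" "x \<noteq> 0" using fn.subspace_0[OF V(2)] by auto
      then show ?thesis using dual_on_separates[OF _ _ V(2)] that by fastforce
    qed
    \<comment> \<open>For \<open>k = 0\<close> the hyperplane is \<open>{0}\<close>, where all forms vanish, so restriction to it is not injective.\<close>
    have k: "1 \<le> k"
    proof (rule ccontr)
      assume "\<not> 1 \<le> k"
      then have "card (?ker l) = 1" using cH[OF l] by simp
      then have H0: "?ker l = {0}"
        using fn.subspace_0[OF H[OF l(1)]] by (rule singleton_if_card_1)
      have "cut_to (?ker l) f = 0" if "f \<in> W" for f
      proof -
        have "f 0 = 0"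
          using quad_onD(1)[of f V 0 0] fn.subspace_0[OF V(2)] W(2) that
          by (auto simp: scl_def zero_fun_def)
        then show ?thesis unfolding H0 by (auto simp: cut_to_def)
      qed
      then have "cut_to (?ker l) ` W \<subseteq> {0}" by auto
      then have "card (cut_to (?ker l) ` W) \<le> 1"
        using card_mono[of "{0 :: ('i \<Rightarrow> 'a) \<Rightarrow> 'a}"] by fastforce
      then have "?q ^ r \<le> 1" using cut[OF l] cW by simp
      moreover have "?q ^ 1 \<le> ?q ^ r"
        using q Suc.prems(7) by (intro power_increasing) auto
      ultimately show False using q by simp
    qed
    have "(int (card ?X) - 1) * (int ?q ^ k - 1)
        \<le> (int ?q ^ Suc k - 1) * (int (quad_bound ?q k (min r k)) - 1)"
    proof (rule average_over_hyperplanes[OF V cV])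
      show "0 \<in> ?X"
        using quad_onD(1)[of _ V 0 0] fn.subspace_0[OF V(2)] W(2)
        by (auto simp: scl_def zero_fun_def)
      fix l assume l: "l \<in> dual_on V" "l \<noteq> 0"
      have "?q ^ min r k \<le> ?q ^ r" using q by (intro power_increasing) auto
      then have "?q ^ min r k \<le> card (cut_to (?ker l) ` W)" using cut[OF l] cW by simp
      then have "card {x \<in> V. l x = 0 \<and> (\<forall>f\<in>W. f x = 0)} \<le> quad_bound ?q k (min r k)"
        using IH[OF l] k Suc.prems(7) by simp
      moreover have "{x \<in> ?X. l x = 0} = {x \<in> V. l x = 0 \<and> (\<forall>f\<in>W. f x = 0)}" by auto
      ultimately show "card {x \<in> ?X. l x = 0} \<le> quad_bound ?q k (min r k)" by simp
    qed auto
    then show ?thesis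
      using quad_bound_average[OF q k Suc.prems(7,8)] by fastforce
  qed
qed


section \<open>Homogeneous polynomials of degree two as quadratic forms\<close>

lemma subspace_supported_on: "fn.subspace (supported_on B)"
  by (auto simp: fn.subspace_def supported_on_def)

text \<open>
  The set \<open>supported_on {0..m}\<close> is the space of vectors of length \<open>m + 1\<close>, and the coordinate subspaces
  that occur for the extremal system are of this kind as well.
\<close>
lemma card_supported_on:
  assumes "finite B"
  shows "card (supported_on B :: ('b \<Rightarrow> 'a::{finite,zero}) set) = CARD('a) ^ card B"
proof -
  have "bij_betw (\<lambda>x. restrict x B) (supported_on B :: ('b \<Rightarrow> 'a) set) (B \<rightarrow>\<^sub>E UNIV)"
    by (rule bij_betwI[where g = "\<lambda>f i. if i \<in> B then f i else 0"])
      (auto simp: supported_on_def fun_eq_iff restrict_def PiE_def extensional_def)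
  then show ?thesis
    using assms by (simp add: bij_betw_same_card card_PiE)
qed

definition monom_eval :: "(nat \<Rightarrow> 'a::field) \<Rightarrow> (nat \<Rightarrow>\<^sub>0 nat) \<Rightarrow> 'a" where
  "monom_eval x t = (\<Prod>i\<in>Poly_Mapping.keys t. x i ^ Poly_Mapping.lookup t i)"

text \<open>
  The monomial \<open>x\<^sub>i x\<^sub>j\<close>; the case \<open>i = j\<close> is included.
\<close>
definition pair_monom :: "nat \<Rightarrow> nat \<Rightarrow> nat \<Rightarrow>\<^sub>0 nat" where
  "pair_monom i j = Poly_Mapping.single i 1 + Poly_Mapping.single j 1"

lemma lookup_pair_monom:
  "Poly_Mapping.lookup (pair_monom i j) k = (if k = i then 1 else 0) + (if k = j then 1 else 0)"
  by (simp add: pair_monom_def lookup_add lookup_single when_def)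

lemma keys_pair_monom: "Poly_Mapping.keys (pair_monom i j) = {i, j}"
  by (auto simp: in_keys_iff lookup_pair_monom split: if_splits)

lemma monom_eval_pair_monom: "monom_eval x (pair_monom i j) = x i * x j"
  by (cases "i = j") (auto simp: monom_eval_def keys_pair_monom lookup_pair_monom power2_eq_square
      simp flip: numeral_2_eq_2)

lemma pair_monom_inject_left: "pair_monom i j = pair_monom i k \<longleftrightarrow> j = k"
  by (simp add: pair_monom_def poly_mapping_eq_iff fun_eq_iff lookup_add lookup_single when_def)
     (metis one_neq_zero)

lemma pair_monom_if_degree_2:
  assumes "(\<Sum>i\<in>Poly_Mapping.keys t. Poly_Mapping.lookup t i) = 2"
  shows "\<exists>i j. t = pair_monom i j"
proof -
  let ?K = "Poly_Mapping.keys t" and ?l = "Poly_Mapping.lookup t"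
  have "?K \<noteq> {}"
  proof
    assume "?K = {}"
    then show False using assms by (simp only: sum.empty)
  qed
  then obtain i where i: "i \<in> ?K" by blast
  then have li: "?l i \<noteq> 0" by (simp add: in_keys_iff)
  have sum: "?l i + (\<Sum>k\<in>?K - {i}. ?l k) = 2"
    using assms sum.remove[OF _ i, of ?l] by simp
  have out: "?l k = 0" if "k \<notin> ?K" for k using that by (simp add: in_keys_iff)
  show ?thesis
  proof (cases "?l i = 1")
    case True
    then have "(\<Sum>k\<in>?K - {i}. ?l k) = 1" using sum by simp
    then obtain j where j: "j \<in> ?K - {i}" "?l j = 1" "\<forall>k\<in>?K - {i}. j \<noteq> k \<longrightarrow> ?l k = 0"
      using sum_eq_1_iff[of "?K - {i}" ?l] by auto
    have "t = pair_monom i j"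
    proof (rule poly_mapping_eqI)
      show "?l k = Poly_Mapping.lookup (pair_monom i j) k" for k
        using j True out[of k] by (cases "k \<in> ?K") (auto simp: lookup_pair_monom)
    qed
    then show ?thesis by blast
  next
    case False
    then have i2: "?l i = 2" and "(\<Sum>k\<in>?K - {i}. ?l k) = 0" using li sum by linarith+
    then have z: "?l k = 0" if "k \<in> ?K - {i}" for k using that by simp
    have "t = pair_monom i i"
    proof (rule poly_mapping_eqI)
      show "?l k = Poly_Mapping.lookup (pair_monom i i) k" for k
        using i2 z[of k] out[of k] by (cases "k \<in> ?K") (auto simp: lookup_pair_monom)
    qed
    then show ?thesis by blast
  qed
qed

lemma homogeneous_2_keys:
  assumes "homogeneous m 2 F" "t \<in> Poly_Mapping.keys F"
  obtains i j where "i \<le> m" "j \<le> m" "t = pair_monom i j"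
proof -
  have K: "Poly_Mapping.keys t \<subseteq> {0..m}" and
    s: "(\<Sum>i\<in>Poly_Mapping.keys t. Poly_Mapping.lookup t i) = 2"
    using assms by (auto simp: homogeneous_def)
  from pair_monom_if_degree_2[OF s] obtain i j where t: "t = pair_monom i j" by auto
  show ?thesis using K that[of i j] t by (simp add: keys_pair_monom)
qed

lemma mpoly_eval_eq:
  assumes "finite T" "Poly_Mapping.keys F \<subseteq> T"
  shows "mpoly_eval x F = (\<Sum>t\<in>T. Poly_Mapping.lookup F t * monom_eval x t)"
  unfolding mpoly_eval_def monom_eval_def
  using assms by (intro sum.mono_neutral_left) (auto simp: in_keys_iff)

lemma mpoly_eval_add: "mpoly_eval x (F + G) = mpoly_eval x F + mpoly_eval x G"
proof -
  let ?T = "Poly_Mapping.keys F \<union> Poly_Mapping.keys G"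
  have "Poly_Mapping.keys (F + G) \<subseteq> ?T" by (rule keys_add)
  then show ?thesis
    by (simp add: mpoly_eval_eq[of ?T] lookup_add distrib_right sum.distrib)
qed

lemma lookup_mpoly_smult: "Poly_Mapping.lookup (mpoly_smult c F) t = c * Poly_Mapping.lookup F t"
  unfolding mpoly_smult_def mult_map_scale_conv_mult[symmetric]
  by (simp add: map.rep_eq when_def)

lemma keys_mpoly_smult: "Poly_Mapping.keys (mpoly_smult c F) \<subseteq> Poly_Mapping.keys F"
  by (auto simp: in_keys_iff lookup_mpoly_smult)

lemma mpoly_eval_smult: "mpoly_eval x (mpoly_smult c F) = c * mpoly_eval x F"
  using keys_mpoly_smult[of c F]
  by (simp add: mpoly_eval_eq[of "Poly_Mapping.keys F"] lookup_mpoly_smult sum_distrib_left mult.assoc)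

lemma mpoly_eval_0: "mpoly_eval x 0 = 0"
  by (simp add: mpoly_eval_def)

lemma subspace_homogeneous: "mpoly.subspace {F. homogeneous m d F}"
proof (rule mpoly.subspaceI)
  show "F + G \<in> {F. homogeneous m d F}"
    if "F \<in> {F. homogeneous m d F}" "G \<in> {F. homogeneous m d F}" for F G :: "'a mpoly"
    using that keys_add[of F G] by (auto simp: homogeneous_def)
  show "mpoly_smult c F \<in> {F. homogeneous m d F}"
    if "F \<in> {F. homogeneous m d F}" for c and F :: "'a mpoly"
    using that keys_mpoly_smult[of c F] by (auto simp: homogeneous_def)
qed (simp add: homogeneous_def)

abbreviation vecs :: "nat \<Rightarrow> (nat \<Rightarrow> 'a::zero) set" where
  "vecs m \<equiv> supported_on {0..m}"

definition poly_fun :: "nat \<Rightarrow> 'a::field mpoly \<Rightarrow> (nat \<Rightarrow> 'a) \<Rightarrow> 'a" where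
  "poly_fun m F = cut_to (vecs m) (\<lambda>x. mpoly_eval x F)"

lemma poly_fun_add: "poly_fun m (F + G) = poly_fun m F + poly_fun m G"
  by (auto simp: poly_fun_def cut_to_def mpoly_eval_add)

lemma poly_fun_smult: "poly_fun m (mpoly_smult c F) = scl c (poly_fun m F)"
  by (auto simp: poly_fun_def cut_to_def mpoly_eval_smult)

lemma poly_fun_0: "poly_fun m 0 = 0"
  by (auto simp: poly_fun_def cut_to_def mpoly_eval_0)

lemma coordinate_product_in_quad_on:
  assumes V: "fn.subspace V"
  shows "cut_to V (\<lambda>x. x i * x j) \<in> quad_on V"
  using fn.subspace_add[OF V] fn.subspace_scale[OF V]
  unfolding quad_on_def dual_on_def supported_on_def
  by (auto simp: cut_to_def algebra_simps power2_eq_square)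

lemma sum_apply: "(\<Sum>a\<in>A. f a) x = (\<Sum>a\<in>A. f a x)"
  by (induction A rule: infinite_finite_induct) auto

lemma poly_fun_in_quad_on:
  assumes "homogeneous m 2 F"
  shows "poly_fun m F \<in> quad_on (vecs m)"
proof -
  let ?V = "vecs m :: (nat \<Rightarrow> 'a) set"
  have "poly_fun m F = (\<Sum>t\<in>Poly_Mapping.keys F.
      scl (Poly_Mapping.lookup F t) (cut_to ?V (\<lambda>x. monom_eval x t)))"
  proof
    fix x
    show "poly_fun m F x = (\<Sum>t\<in>Poly_Mapping.keys F.
      scl (Poly_Mapping.lookup F t) (cut_to ?V (\<lambda>x. monom_eval x t))) x"
      by (cases "x \<in> ?V")
        (simp_all add: poly_fun_def cut_to_def mpoly_eval_eq[of "Poly_Mapping.keys F"] sum_apply)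
  qed
  also have "\<dots> \<in> quad_on ?V"
  proof (intro fn.subspace_sum fn.subspace_scale subspace_quad_on subspace_supported_on)
    fix t assume "t \<in> Poly_Mapping.keys F"
    then obtain i j where "t = pair_monom i j" using homogeneous_2_keys[OF assms] by metis
    then show "cut_to ?V (\<lambda>x. monom_eval x t) \<in> quad_on ?V"
      by (simp add: monom_eval_pair_monom coordinate_product_in_quad_on subspace_supported_on)
  qed
  finally show ?thesis .
qed

lemma mpoly_eval_single_out:
  assumes "\<And>t. t \<in> Poly_Mapping.keys F \<Longrightarrow> t \<noteq> s \<Longrightarrow> monom_eval x t = 0"
  shows "mpoly_eval x F = Poly_Mapping.lookup F s * monom_eval x s"
proof -
  have "mpoly_eval x F = (\<Sum>t\<in>insert s (Poly_Mapping.keys F). Poly_Mapping.lookup F t * monom_eval x t)"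
    by (rule mpoly_eval_eq) auto
  also have "\<dots> = Poly_Mapping.lookup F s * monom_eval x s
      + (\<Sum>t\<in>Poly_Mapping.keys F - {s}. Poly_Mapping.lookup F t * monom_eval x t)"
    by (simp add: sum.insert_remove)
  also have "(\<Sum>t\<in>Poly_Mapping.keys F - {s}. Poly_Mapping.lookup F t * monom_eval x t) = 0"
    using assms by (intro sum.neutral) auto
  finally show ?thesis by simp
qed

text \<open>
  The diagonal coefficients are the values at the unit vectors \<open>e\<^sub>i\<close>. Once they are known to vanish,
  the coefficient of \<open>x\<^sub>i x\<^sub>j\<close> is the value at \<open>e\<^sub>i + e\<^sub>j\<close>. The argument uses only the values 0 and 1 of the
  coordinates and therefore holds over every field.
\<close>
lemma poly_fun_eq_0:
  fixes F :: "'a::field mpoly"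
  assumes F: "homogeneous m 2 F" and zero: "poly_fun m F = 0"
  shows "F = 0"
proof (rule ccontr)
  assume "F \<noteq> 0"
  then obtain t where t: "t \<in> Poly_Mapping.keys F" by (metis all_not_in_conv keys_eq_empty)
  have ev: "mpoly_eval x F = 0" if "x \<in> vecs m" for x
    using fun_cong[OF zero, of x] that by (simp add: poly_fun_def cut_to_def)
  \<comment> \<open>The sum of the unit vectors with index in \<open>A\<close>.\<close>
  define e where "e A = (\<lambda>k :: nat. if k \<in> A then 1 else 0 :: 'a)" for A
  have diag: "Poly_Mapping.lookup F (pair_monom i i) = 0" if "i \<le> m" for i
  proof -
    have "mpoly_eval (e {i}) F = Poly_Mapping.lookup F (pair_monom i i) * monom_eval (e {i}) (pair_monom i i)"
    proof (rule mpoly_eval_single_out)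
      fix s assume s: "s \<in> Poly_Mapping.keys F" "s \<noteq> pair_monom i i"
      from homogeneous_2_keys[OF F s(1)] obtain a b where "s = pair_monom a b" .
      then show "monom_eval (e {i}) s = 0"
        using s(2) by (auto simp: monom_eval_pair_monom e_def)
    qed
    moreover have "e {i} \<in> vecs m" using that by (auto simp: e_def supported_on_def)
    ultimately show ?thesis using ev by (simp add: monom_eval_pair_monom e_def)
  qed
  from homogeneous_2_keys[OF F t] obtain i j where ij: "i \<le> m" "j \<le> m" "t = pair_monom i j" .
  have "mpoly_eval (e {i, j}) F = Poly_Mapping.lookup F t * monom_eval (e {i, j}) t"
  proof (rule mpoly_eval_single_out)
    fix s assume s: "s \<in> Poly_Mapping.keys F" "s \<noteq> t"
    from homogeneous_2_keys[OF F s(1)] obtain a b where ab: "a \<le> m" "s = pair_monom a b" .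
    then have "a \<noteq> b" using diag s(1) by (auto simp: in_keys_iff)
    moreover have "pair_monom j i = pair_monom i j" by (simp add: pair_monom_def add.commute)
    ultimately show "monom_eval (e {i, j}) s = 0"
      using s(2) ab ij by (auto simp: monom_eval_pair_monom e_def)
  qed
  moreover have "e {i, j} \<in> vecs m" using ij by (auto simp: e_def supported_on_def)
  ultimately have "Poly_Mapping.lookup F t = 0"
    using ev ij by (simp add: monom_eval_pair_monom e_def)
  then show False using t by (simp add: in_keys_iff)
qed

lemma card_mpoly_span:
  fixes S :: "'a::{field,finite} mpoly set"
  assumes fin: "finite S" and ind: "mpoly.independent S"
  shows "finite (mpoly.span S)" "card (mpoly.span S) = CARD('a) ^ card S"
proof -
  let ?c = "\<lambda>u. \<Sum>v\<in>S. mpoly_smult (u v) v"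
  have "?c u \<in> ?c ` (S \<rightarrow>\<^sub>E UNIV)" for u
    by (rule image_eqI[of _ _ "restrict u S"]) (auto intro: sum.cong)
  then have span: "mpoly.span S = ?c ` (S \<rightarrow>\<^sub>E UNIV)"
    unfolding mpoly.span_finite[OF fin] by blast
  have "inj_on ?c (S \<rightarrow>\<^sub>E UNIV)"
  proof (rule inj_onI)
    fix u w :: "'a mpoly \<Rightarrow> 'a"
    assume u: "u \<in> S \<rightarrow>\<^sub>E UNIV" and w: "w \<in> S \<rightarrow>\<^sub>E UNIV" and "?c u = ?c w"
    then have "(\<Sum>v\<in>S. mpoly_smult (u v - w v) v) = 0"
      by (simp add: mpoly.scale_left_diff_distrib sum_subtractf)
    moreover have "mpoly.dependent S"
      if "v \<in> S" "u v - w v \<noteq> 0" "(\<Sum>v\<in>S. mpoly_smult (u v - w v) v) = 0" for v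
      unfolding mpoly.dependent_finite[OF fin] using that by (intro exI[of _ "\<lambda>v. u v - w v"]) auto
    ultimately have "u v - w v = 0" if "v \<in> S" for v
      using ind that by metis
    then show "u = w" using u w by (intro PiE_ext) auto
  qed
  then show "card (mpoly.span S) = CARD('a) ^ card S"
    using fin by (simp add: span card_image card_PiE)
  show "finite (mpoly.span S)"
    using fin by (simp add: span finite_PiE)
qed

text \<open>
  The forms that are obtained from the span of \<open>S\<close> constitute a space with \<open>q\<^sup>r\<close> elements, because
  a homogeneous polynomial of degree two is determined by its form.
\<close>
lemma card_affine_zeros_le:
  fixes S :: "'a::{field,finite} mpoly set"
  assumes S: "finite S" "mpoly.independent S" "\<And>F. F \<in> S \<Longrightarrow> homogeneous m 2 F"
    and r: "card S = r" "1 \<le> r" "r \<le> m + 1"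
  shows "card {x \<in> vecs m. \<forall>F\<in>S. mpoly_eval x F = 0} \<le> quad_bound CARD('a) (m + 1) r"
proof -
  let ?V = "vecs m :: (nat \<Rightarrow> 'a) set" and ?P = "mpoly.span S"
  define W where "W = poly_fun m ` ?P"
  have finV: "finite ?V" by (simp add: finite_supported_on)
  have hom: "homogeneous m 2 F" if "F \<in> ?P" for F
    using mpoly.span_minimal[of S "{F. homogeneous m 2 F}"] S(3) subspace_homogeneous that by auto
  have W: "fn.subspace W"
  proof (rule fn.subspaceI)
    show "0 \<in> W" unfolding W_def
      by (rule image_eqI[OF _ mpoly.span_zero]) (simp add: poly_fun_0)
  next
    fix f g assume "f \<in> W" "g \<in> W"
    then obtain F G where "F \<in> ?P" "G \<in> ?P" "f = poly_fun m F" "g = poly_fun m G"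
      by (auto simp: W_def)
    then show "f + g \<in> W"
      unfolding W_def by (intro image_eqI[of _ _ "F + G"]) (simp_all add: poly_fun_add mpoly.span_add)
  next
    fix c f assume "f \<in> W"
    then obtain F where "F \<in> ?P" "f = poly_fun m F" by (auto simp: W_def)
    then show "scl c f \<in> W"
      unfolding W_def
      by (intro image_eqI[of _ _ "mpoly_smult c F"]) (simp_all add: poly_fun_smult mpoly.span_scale)
  qed
  have WQ: "W \<subseteq> quad_on ?V"
    using hom poly_fun_in_quad_on by (auto simp: W_def)
  have "{F \<in> ?P. poly_fun m F = 0} = {0}"
    using hom poly_fun_eq_0 poly_fun_0 mpoly.span_zero by blast
  moreover have "card ?P = card W * card {F \<in> ?P. poly_fun m F = 0}"
    unfolding W_def
    by (rule card_eq_image_times_kernel[OF card_mpoly_span(1)[OF S(1,2)]])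
      (simp_all add: mpoly.span_add mpoly.span_diff poly_fun_add)
  ultimately have cW: "card W = CARD('a) ^ r"
    using card_mpoly_span(2)[OF S(1,2)] r(1) by simp
  have "mpoly_eval x F = 0" if F: "F \<in> ?P" and x: "\<And>G. G \<in> S \<Longrightarrow> mpoly_eval x G = 0" for x F
  proof -
    have "mpoly.subspace {G. mpoly_eval x G = 0}"
      by (rule mpoly.subspaceI) (auto simp: mpoly_eval_add mpoly_eval_smult mpoly_eval_0)
    then show ?thesis using mpoly.span_minimal[of S "{G. mpoly_eval x G = 0}"] F x by auto
  qed
  then have "{x \<in> ?V. \<forall>F\<in>S. mpoly_eval x F = 0} \<subseteq> {x \<in> ?V. \<forall>f\<in>W. f x = 0}"
    by (auto simp: W_def poly_fun_def cut_to_def)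
  then have "card {x \<in> ?V. \<forall>F\<in>S. mpoly_eval x F = 0} \<le> card {x \<in> ?V. \<forall>f\<in>W. f x = 0}"
    using finV by (intro card_mono) auto
  also have "\<dots> \<le> quad_bound CARD('a) (m + 1) r"
    by (rule card_common_zeros_le[OF finV subspace_supported_on _ W WQ])
      (use cW r in \<open>simp_all add: card_supported_on\<close>)
  finally show ?thesis .
qed

section \<open>Projective zeros\<close>

lemma equiv_proportional:
  "equiv (nonzero_vecs m) (proportional m :: ((nat \<Rightarrow> 'a::field) \<times> _) set)"
proof (rule equivI)
  show "proportional m \<subseteq> nonzero_vecs m \<times> (nonzero_vecs m :: (nat \<Rightarrow> 'a) set)"
    by (auto simp: proportional_def)
  show "refl_on (nonzero_vecs m) (proportional m :: ((nat \<Rightarrow> 'a) \<times> _) set)"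
    by (auto simp: refl_on_def proportional_def intro!: exI[of _ 1])
  show "sym (proportional m :: ((nat \<Rightarrow> 'a) \<times> _) set)"
  proof (rule symI)
    fix x y :: "nat \<Rightarrow> 'a"
    assume "(x, y) \<in> proportional m"
    then obtain c where c: "x \<in> nonzero_vecs m" "y \<in> nonzero_vecs m" "c \<noteq> 0" "y = (\<lambda>i. c * x i)"
      unfolding proportional_def by blast
    have "inverse c \<noteq> 0" "x = (\<lambda>i. inverse c * y i)"
      using c(3) by (simp_all add: c(4) flip: mult.assoc)
    with c(1,2) show "(y, x) \<in> proportional m" unfolding proportional_def by blast
  qed
  show "trans (proportional m :: ((nat \<Rightarrow> 'a) \<times> _) set)"
  proof (rule transI)
    fix x y z :: "nat \<Rightarrow> 'a"
    assume "(x, y) \<in> proportional m" "(y, z) \<in> proportional m"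
    then obtain c d where c: "x \<in> nonzero_vecs m" "z \<in> nonzero_vecs m" "c \<noteq> 0" "d \<noteq> 0"
        "y = (\<lambda>i. c * x i)" "z = (\<lambda>i. d * y i)"
      unfolding proportional_def by blast
    have "d * c \<noteq> 0" "z = (\<lambda>i. (d * c) * x i)"
      using c(3,4) by (simp_all add: c(5,6) mult.assoc)
    with c(1,2) show "(x, z) \<in> proportional m" unfolding proportional_def by blast
  qed
qed

lemma proportional_class:
  assumes "x \<in> nonzero_vecs m"
  shows "proportional m `` {x} = (\<lambda>c. scl c x) ` (UNIV - {0})"
  using assms by (auto simp: proportional_def nonzero_vecs_def scl_def)

text \<open>
  The nonzero vectors at which \<open>S\<close> vanishes are the disjoint union of the projective zeros, each of
  which consists of \<open>CARD('a) - 1\<close> vectors; the summand 1 accounts for the zero vector.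
\<close>
lemma card_proj_zeros:
  fixes S :: "'a::{field,finite} mpoly set"
  assumes hom: "\<And>F. F \<in> S \<Longrightarrow> homogeneous m 2 F"
  shows "(CARD('a) - 1) * card (proj_zeros m S) + 1
    = card {x \<in> vecs m. \<forall>F\<in>S. mpoly_eval x F = 0}"
proof -
  let ?N = "nonzero_vecs m :: (nat \<Rightarrow> 'a) set" and ?V = "vecs m :: (nat \<Rightarrow> 'a) set"
  let ?Z = "{x \<in> ?V. \<forall>F\<in>S. mpoly_eval x F = 0}"
  have N: "?N = ?V - {0}"
    by (auto simp: nonzero_vecs_def supported_on_def fun_eq_iff)
  have finV: "finite ?V" by (simp add: finite_supported_on)
  have scale: "mpoly_eval (scl c x) F = c\<^sup>2 * mpoly_eval x F" if "F \<in> S" "x \<in> ?V" for F c x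
    using quad_onD(1)[OF poly_fun_in_quad_on[OF hom[OF that(1)]] that(2)]
      that(2) fn.subspace_scale[OF subspace_supported_on that(2)]
    by (simp add: poly_fun_def cut_to_def)
  have point: "\<exists>x\<in>?N. P = (\<lambda>c. scl c x) ` (UNIV - {0})" if "P \<in> proj_space m" for P
    using that by (auto simp: proj_space_def quotient_def proportional_class)
  have union: "\<Union> (proj_zeros m S) = ?Z - {0}"
  proof (intro equalityI subsetI)
    fix x assume "x \<in> \<Union> (proj_zeros m S)"
    then obtain P where P: "P \<in> proj_space m" "x \<in> P" "\<forall>F\<in>S. mpoly_eval x F = 0"
      by (auto simp: proj_zeros_def)
    then have "x \<in> ?N"
      using Union_quotient[OF equiv_proportional] unfolding proj_space_def by blast
    then show "x \<in> ?Z - {0}" using P(3) N by auto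
  next
    fix x assume x: "x \<in> ?Z - {0}"
    then have xN: "x \<in> ?N" using N by auto
    let ?P = "(\<lambda>c. scl c x) ` (UNIV - {0})"
    have "?P \<in> proj_space m"
      using quotientI[OF xN, of "proportional m"] by (simp add: proj_space_def proportional_class[OF xN])
    moreover have "\<forall>F\<in>S. \<forall>y\<in>?P. mpoly_eval y F = 0" using x scale by auto
    moreover have "x \<in> ?P" by (rule image_eqI[of _ _ 1]) auto
    ultimately show "x \<in> \<Union> (proj_zeros m S)" unfolding proj_zeros_def by blast
  qed
  have finU: "finite (\<Union> (proj_zeros m S))" using finV union by simp
  have "(CARD('a) - 1) * card (proj_zeros m S) = card (\<Union> (proj_zeros m S))"
  proof (rule card_partition)
    show "finite (proj_zeros m S)" using finU by (rule finite_UnionD)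
    show "finite (\<Union> (proj_zeros m S))" by (rule finU)
  next
    fix P assume "P \<in> proj_zeros m S"
    then have "P \<in> proj_space m" by (simp add: proj_zeros_def)
    from point[OF this] obtain x where x: "x \<in> ?N" "P = (\<lambda>c. scl c x) ` (UNIV - {0})" ..
    then obtain k where "x k \<noteq> 0" by (auto simp: nonzero_vecs_def)
    then have "inj_on (\<lambda>c. scl c x) (UNIV - {0})"
      by (auto simp: inj_on_def fun_eq_iff)
    then show "card P = CARD('a) - 1" by (simp add: x(2) card_image)
  next
    fix P Q :: "(nat \<Rightarrow> 'a) set"
    assume "P \<in> proj_zeros m S" "Q \<in> proj_zeros m S" "P \<noteq> Q"
    then show "P \<inter> Q = {}"
      using quotient_disj[OF equiv_proportional] by (auto simp: proj_zeros_def proj_space_def)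
  qed
  moreover have "0 \<in> ?Z"
  proof -
    have "mpoly_eval 0 F = 0" if "F \<in> S" for F
      using scale[OF that, of 0 0] fn.subspace_0[OF subspace_supported_on[of "{0..m}"]]
      by (simp add: scl_def zero_fun_def)
    then show ?thesis using fn.subspace_0[OF subspace_supported_on] by auto
  qed
  then have "card (?Z - {0}) + 1 = card ?Z"
    using finV card_Suc_Diff1[of ?Z 0] by simp
  ultimately show ?thesis unfolding union by simp
qed

text \<open>
  This is \<open>p\<^bsub>m-1\<^esub> + \<lfloor>q\<^bsup>m-r\<^esup>\<rfloor>\<close>.
\<close>
definition max_zeros :: "nat \<Rightarrow> nat \<Rightarrow> nat \<Rightarrow> nat" where
  "max_zeros q m r = (\<Sum>i<m. q ^ i) + (if r \<le> m then q ^ (m - r) else 0)"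

lemma quad_bound_eq_max_zeros:
  assumes "2 \<le> q"
  shows "quad_bound q (m + 1) r = (q - 1) * max_zeros q m r + 1"
proof -
  have "int q ^ m - 1 = (int q - 1) * (\<Sum>i<m. int q ^ i)" by (rule power_diff_1_eq)
  then have "int (q ^ m) = int ((q - 1) * (\<Sum>i<m. q ^ i) + 1)"
    using assms by (simp add: of_nat_diff)
  then have "q ^ m = (q - 1) * (\<Sum>i<m. q ^ i) + 1" by (simp only: of_nat_eq_iff)
  then show ?thesis by (auto simp: quad_bound_def max_zeros_def distrib_left)
qed

lemma card_proj_zeros_le:
  fixes S :: "'a::{field,finite} mpoly set"
  assumes "finite S" "mpoly.independent S" "\<And>F. F \<in> S \<Longrightarrow> homogeneous m 2 F"
    and "card S = r" "1 \<le> r" "r \<le> m + 1"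
  shows "card (proj_zeros m S) \<le> max_zeros CARD('a) m r"
proof -
  have q: "2 \<le> CARD('a)" by (rule two_le_card_field)
  have "(CARD('a) - 1) * card (proj_zeros m S) + 1 \<le> (CARD('a) - 1) * max_zeros CARD('a) m r + 1"
    using card_affine_zeros_le[OF assms] card_proj_zeros[OF assms(3)]
    unfolding quad_bound_eq_max_zeros[OF q] by simp
  then show ?thesis using q by simp
qed

section \<open>A system with the maximal number of zeros\<close>

text \<open>
  The form \<open>x\<^sub>0 x\<^sub>i\<close> for \<open>1 \<le> i \<le> m\<close>, and \<open>x\<^sub>0\<^sup>2\<close> for \<open>i = m + 1\<close>.
\<close>
definition extremal_form :: "nat \<Rightarrow> nat \<Rightarrow> 'a::field mpoly" where
  "extremal_form m i = Poly_Mapping.single (pair_monom 0 (if i \<le> m then i else 0)) 1"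

lemma mpoly_eval_extremal_form:
  "mpoly_eval x (extremal_form m i) = x 0 * x (if i \<le> m then i else 0)"
  by (simp add: extremal_form_def monom_eval_pair_monom
      mpoly_eval_eq[of "{pair_monom 0 (if i \<le> m then i else 0)}"])

lemma homogeneous_extremal_form: "homogeneous m 2 (extremal_form m i)"
  by (auto simp: homogeneous_def extremal_form_def keys_pair_monom lookup_pair_monom sum.distrib)

lemma inj_on_extremal_form: "inj_on (extremal_form m :: nat \<Rightarrow> 'a::field mpoly) {1..m + 1}"
proof (rule inj_onI)
  fix i k assume ik: "i \<in> {1..m + 1}" "k \<in> {1..m + 1}"
    and eq: "extremal_form m i = (extremal_form m k :: 'a mpoly)"
  have "Poly_Mapping.keys (extremal_form m i :: 'a mpoly) = Poly_Mapping.keys (extremal_form m k :: 'a mpoly)"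
    using eq by (rule arg_cong)
  then have "(if i \<le> m then i else 0) = (if k \<le> m then k else 0)"
    by (simp only: extremal_form_def keys_single pair_monom_inject_left one_neq_zero if_False
        singleton_insert_inj_eq simp_thms)
  then show "i = k" using ik by (auto split: if_splits)
qed

lemma independent_extremal_form:
  assumes "r \<le> m + 1"
  shows "mpoly.independent ((extremal_form m :: nat \<Rightarrow> 'a::field mpoly) ` {1..r})"
proof
  let ?F = "extremal_form m :: nat \<Rightarrow> 'a mpoly"
  let ?t = "\<lambda>i. pair_monom 0 (if i \<le> m then i else 0)"
  assume "mpoly.dependent (?F ` {1..r})"
  then obtain u where u: "\<exists>v\<in>?F ` {1..r}. u v \<noteq> 0" "(\<Sum>v\<in>?F ` {1..r}. mpoly_smult (u v) v) = 0"
    using mpoly.dependent_finite[of "?F ` {1..r}"] by auto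
  have inj: "inj_on ?F {1..r}"
    by (rule inj_on_subset[OF inj_on_extremal_form]) (use assms in auto)
  have "u (?F k) = 0" if k: "k \<in> {1..r}" for k
  proof -
    have look: "Poly_Mapping.lookup (?F i) (?t k) = (if i = k then 1 else 0)" if "i \<in> {1..r}" for i
      using that k assms
      by (auto simp: extremal_form_def lookup_single when_def pair_monom_inject_left)
    have "0 = Poly_Mapping.lookup (\<Sum>i\<in>{1..r}. mpoly_smult (u (?F i)) (?F i)) (?t k)"
      using u(2) unfolding sum.reindex[OF inj] o_def by simp
    also have "\<dots> = (\<Sum>i\<in>{1..r}. if i = k then u (?F i) else 0)"
      unfolding lookup_sum lookup_mpoly_smult by (rule sum.cong) (simp_all add: look)
    also have "\<dots> = u (?F k)" using k by simp
    finally show ?thesis by simp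
  qed
  then show False using u(1) by auto
qed

text \<open>
  Two disjoint sets of zeros are enough: the hyperplane \<open>x\<^sub>0 = 0\<close> and, if \<open>r \<le> m\<close>, the vectors with
  \<open>x\<^sub>1 = \<dots> = x\<^sub>r = 0\<close> and \<open>x\<^sub>0 \<noteq> 0\<close>, the latter as a difference of two coordinate subspaces.
\<close>
lemma card_proj_zeros_extremal_form:
  assumes r: "1 \<le> r" "r \<le> m + 1"
  shows "max_zeros CARD('a) m r
    \<le> card (proj_zeros m ((extremal_form m :: nat \<Rightarrow> 'a::{field,finite} mpoly) ` {1..r}))"
proof -
  let ?F = "extremal_form m :: nat \<Rightarrow> 'a mpoly" and ?q = "CARD('a)"
  let ?Z = "{x \<in> vecs m. \<forall>F\<in>?F ` {1..r}. mpoly_eval x F = 0}"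
  let ?H = "supported_on {1..m} :: (nat \<Rightarrow> 'a) set"
  have q: "2 \<le> ?q" by (rule two_le_card_field)
  have fin: "finite (supported_on B :: (nat \<Rightarrow> 'a) set)" if "finite B" for B
    using that by (rule finite_supported_on)
  have finZ: "finite ?Z" using fin by simp
  have H: "?H \<subseteq> ?Z" by (auto simp: supported_on_def mpoly_eval_extremal_form)
  have "quad_bound ?q (m + 1) r \<le> card ?Z"
  proof (cases "r \<le> m")
    case True
    let ?L = "supported_on (insert 0 {r + 1..m}) :: (nat \<Rightarrow> 'a) set"
    let ?K = "supported_on {r + 1..m} :: (nat \<Rightarrow> 'a) set"
    have L: "?L - ?K \<subseteq> ?Z"
      using True by (auto simp: supported_on_def mpoly_eval_extremal_form)
    have KL: "?K \<subseteq> ?L" by (auto simp: supported_on_def)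
    have disj: "?H \<inter> (?L - ?K) = {}"
    proof -
      have "x \<in> ?K" if "x \<in> ?H" "x \<in> ?L" for x
        unfolding supported_on_def
      proof (intro CollectI allI impI)
        fix i assume "i \<notin> {r + 1..m}"
        then show "x i = 0"
          using that by (cases "i = 0") (auto simp: supported_on_def)
      qed
      then show ?thesis by blast
    qed
    have "card (?H \<union> (?L - ?K)) = card ?H + (card ?L - card ?K)"
      using fin disj KL by (simp add: card_Un_disjoint card_Diff_subset)
    also have "\<dots> = ?q ^ m + (?q - 1) * ?q ^ (m - r)"
      by (simp add: card_supported_on diff_mult_distrib)
    finally have "card (?H \<union> (?L - ?K)) = ?q ^ m + (?q - 1) * ?q ^ (m - r)" .
    moreover have "card (?H \<union> (?L - ?K)) \<le> card ?Z"
      using H L finZ by (intro card_mono) auto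
    ultimately show ?thesis using True by (simp add: quad_bound_def)
  next
    case False
    have "card ?H \<le> card ?Z" using H finZ by (rule card_mono[rotated])
    then show ?thesis using False by (simp add: quad_bound_def card_supported_on)
  qed
  also have "card ?Z = (?q - 1) * card (proj_zeros m (?F ` {1..r})) + 1"
    by (rule card_proj_zeros[symmetric]) (auto simp: homogeneous_extremal_form)
  finally show ?thesis unfolding quad_bound_eq_max_zeros[OF q] using q by simp
qed


section \<open>The first elements of \<open>\<Lambda> 2 m\<close>\<close>

definition unit_list :: "nat \<Rightarrow> nat \<Rightarrow> nat list" where
  "unit_list m i = (replicate m 0)[i := 1]"

lemma sum_list_eq_0_nat: "sum_list xs = (0 :: nat) \<longleftrightarrow> xs = replicate (length xs) 0"
  by (induction xs) auto

lemma sum_list_eq_1_nat: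
  "sum_list xs = (1 :: nat) \<Longrightarrow> \<exists>i<length xs. xs = unit_list (length xs) i"
proof (induction xs)
  case (Cons x xs)
  show ?case
  proof (cases "x = 0")
    case True
    then obtain i where "i < length xs" "xs = unit_list (length xs) i" using Cons by auto
    then show ?thesis using True by (intro exI[of _ "Suc i"]) (auto simp: unit_list_def)
  next
    case False
    moreover have "x + sum_list xs = 1" using Cons.prems by (simp only: sum_list.Cons)
    ultimately have "x = 1" "sum_list xs = 0" by linarith+
    then show ?thesis using sum_list_eq_0_nat[of xs]
      by (intro exI[of _ 0]) (auto simp: unit_list_def)
  qed
qed simp

lemma unit_list_less:
  "i < k \<Longrightarrow> k < m \<Longrightarrow> unit_list m k < unit_list m i"
proof (induction m arbitrary: i k)
  case (Suc m)
  then show ?case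
    by (cases k; cases i) (auto simp: unit_list_def)
qed simp

text \<open>
  The elements of \<open>\<Lambda> 2 m\<close> with nonzero first entry, in descending order.
\<close>
definition leading_tuples :: "nat \<Rightarrow> nat list list" where
  "leading_tuples m = (2 # replicate m 0) # map (\<lambda>i. 1 # unit_list m i) [0..<m]"

lemma sorted_leading_tuples: "sorted_wrt (>) (leading_tuples m)"
proof -
  have "sorted_wrt (\<lambda>i k. unit_list m k < unit_list m i) [0..<m]"
    by (simp add: sorted_wrt_iff_nth_less unit_list_less)
  then show ?thesis by (simp add: leading_tuples_def sorted_wrt_map)
qed

lemma \<Lambda>_2_eq: "\<Lambda> 2 m = {\<alpha> \<in> \<Lambda> 2 m. hd \<alpha> = 0} \<union> set (leading_tuples m)"
proof (intro equalityI subsetI)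
  fix \<alpha> assume a: "\<alpha> \<in> \<Lambda> 2 m"
  then obtain x xs where x: "\<alpha> = x # xs" "length xs = m" "x + sum_list xs = 2"
    by (cases \<alpha>) (auto simp: \<Lambda>_def)
  then consider "x = 0" | "x = 1" "sum_list xs = 1" | "x = 2" "sum_list xs = 0" by linarith
  then show "\<alpha> \<in> {\<alpha> \<in> \<Lambda> 2 m. hd \<alpha> = 0} \<union> set (leading_tuples m)"
  proof cases
    case 2
    then show ?thesis using sum_list_eq_1_nat[of xs] x by (auto simp: leading_tuples_def)
  next
    case 3
    from 3(2) have "xs = replicate (length xs) 0" unfolding sum_list_eq_0_nat .
    then have "\<alpha> = 2 # replicate m 0" by (simp only: x(1,2) 3(1))
    then show ?thesis by (simp add: leading_tuples_def)
  qed (use a x in simp)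
next
  fix \<alpha> assume "\<alpha> \<in> {\<alpha> \<in> \<Lambda> 2 m. hd \<alpha> = 0} \<union> set (leading_tuples m)"
  then show "\<alpha> \<in> \<Lambda> 2 m"
    by (auto simp: leading_tuples_def \<Lambda>_def unit_list_def sum_list_update)
qed

lemma finite_\<Lambda>: "finite (\<Lambda> d m)"
proof (rule finite_subset)
  show "\<Lambda> d m \<subseteq> {xs. set xs \<subseteq> {..d} \<and> length xs = m + 1}"
    using member_le_sum_list by (auto simp: \<Lambda>_def)
qed (simp add: finite_lists_length_eq)

text \<open>
  Every tuple with first entry 0 is smaller than all leading tuples, so the ascending enumeration of
  \<open>\<Lambda> 2 m\<close> ends with the reversed list of these.
\<close>
lemma \<Lambda>_nth_2:
  assumes "1 \<le> r" "r \<le> m + 1"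
  shows "\<Lambda>_nth 2 m r = leading_tuples m ! (r - 1)"
proof -
  let ?R = "{\<alpha> \<in> \<Lambda> 2 m. hd \<alpha> = 0}"
  have finR: "finite ?R" using finite_\<Lambda> by simp
  have less: "\<alpha> < \<beta>" if "\<alpha> \<in> ?R" "\<beta> \<in> set (leading_tuples m)" for \<alpha> \<beta>
    using that by (cases \<alpha>) (auto simp: leading_tuples_def)
  have "sorted_list_of_set (\<Lambda> 2 m) = sorted_list_of_set ?R @ rev (leading_tuples m)"
  proof (rule strict_sorted_equal)
    show "sorted_wrt (<) (sorted_list_of_set ?R @ rev (leading_tuples m))"
      using less finR sorted_leading_tuples[of m]
      by (simp only: sorted_wrt_append sorted_wrt_rev set_sorted_list_of_set[OF finR] set_rev
          strict_sorted_list_of_set) simp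
    show "set (sorted_list_of_set (\<Lambda> 2 m)) = set (sorted_list_of_set ?R @ rev (leading_tuples m))"
      using \<Lambda>_2_eq[of m]
      by (simp only: set_append set_rev set_sorted_list_of_set[OF finR]
          set_sorted_list_of_set[OF finite_\<Lambda>])
  qed (simp add: strict_sorted_list_of_set)
  moreover have "length (leading_tuples m) = m + 1" by (simp add: leading_tuples_def)
  moreover have "r - 1 < m + 1" using assms by simp
  ultimately show ?thesis by (simp add: \<Lambda>_nth_def nth_append)
qed

text \<open>
  The nonzero entries of the \<open>r\<close>th tuple are at the positions 1 and \<open>r\<close>, and for \<open>r = 1\<close> they add up
  to 2 at position 1. Positions are counted from 1.
\<close>
lemma leading_tuples_nth:
  assumes "1 \<le> r" "r \<le> m + 1" "1 \<le> i" "i \<le> m + 1"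
  shows "leading_tuples m ! (r - 1) ! (i - 1) = (if i = 1 then 1 else 0) + (if i = r then 1 else 0)"
proof (cases "r = 1")
  case True
  then show ?thesis using assms by (cases i) (auto simp: leading_tuples_def nth_Cons split: nat.split)
next
  case False
  define k where "k = r - 2"
  have r: "r = Suc (Suc k)" using False assms by (simp add: k_def)
  have "leading_tuples m ! (r - 1) = 1 # unit_list m k"
    using assms by (simp add: leading_tuples_def r)
  then show ?thesis
    using assms by (auto simp: nth_Cons unit_list_def nth_list_update r split: nat.split)
qed

section \<open>The maximal number of zeros\<close>

lemma p_num_diff: "p_num q (int n) - p_num q (int n - 1) = int q ^ n"
proof (cases n)
  case (Suc k)
  then have "int n - 1 = int k" by simp
  then show ?thesis unfolding \<open>int n - 1 = int k\<close> by (simp add: p_num_def Suc nat_add_distrib)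
qed (simp add: p_num_def)

lemma p_num_eq_sum:
  assumes "m \<ge> 1"
  shows "p_num q (int m - 1) = int (\<Sum>i<m. q ^ i)"
proof -
  have "nat (int m - 1) = m - 1" by simp
  moreover have "{0..m - 1} = {..<m}" using assms by auto
  ultimately show ?thesis using assms by (simp add: p_num_def)
qed

theorem corollary3p2:
  fixes m q r j :: nat and \<nu> :: "nat \<Rightarrow> nat" and cards :: "nat set"
  assumes "m \<ge> 1"
    and "q = CARD('a::{field,finite})"
    and "1 \<le> r" and "r \<le> m + 1"
    and "\<nu> = (\<lambda>i. \<Lambda>_nth 2 m r ! (i - 1))"
    and "j = Min {i \<in> {1..m + 1}. \<nu> i \<noteq> 0}"
    and "cards = {card (proj_zeros m (F ` {1..r})) | F :: nat \<Rightarrow> 'a mpoly.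
           (\<forall>i\<in>{1..r}. homogeneous m 2 (F i)) \<and>
           inj_on F {1..r} \<and> mpoly.independent (F ` {1..r})}"
  shows "int (Max cards) =
           p_num q (int m - 2 * int j) +
           (\<Sum>i=j..m. int (\<nu> i) *
              (p_num q (int m - int i) - p_num q (int m - int i - int j))) \<and>
         int (Max cards) = p_num q (int m - 1) + \<lfloor>real q powi (int m - int r)\<rfloor> \<and>
         p_num q (int m - 1) + \<lfloor>real q powi (int m - int r)\<rfloor> =
           (if r \<in> {1..m} then p_num q (int m - 1) + int q ^ (m - r)
            else p_num q (int m - 1))"
proof -
  have q: "2 \<le> q" unfolding assms(2) by (rule two_le_card_field)
  have Max: "Max cards = max_zeros q m r"
  proof (rule Max_eqI)
    have le: "c \<le> max_zeros q m r" if "c \<in> cards" for c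
    proof -
      from that obtain F :: "nat \<Rightarrow> 'a mpoly" where F: "c = card (proj_zeros m (F ` {1..r}))"
        "\<And>i. i \<in> {1..r} \<Longrightarrow> homogeneous m 2 (F i)"
        "inj_on F {1..r}" "mpoly.independent (F ` {1..r})"
        unfolding assms(7) by blast
      have "card (F ` {1..r}) = r" using card_image[OF F(3)] by simp
      then show ?thesis
        unfolding F(1) assms(2) using F(2,4) assms(3,4) by (intro card_proj_zeros_le) auto
    qed
    then show "finite cards" using finite_nat_set_iff_bounded_le by blast
    show "c \<le> max_zeros q m r" if "c \<in> cards" for c by (rule le[OF that])
    let ?F = "extremal_form m :: nat \<Rightarrow> 'a mpoly"
    have "inj_on ?F {1..r}"
      by (rule inj_on_subset[OF inj_on_extremal_form]) (use assms(4) in auto)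
    then have in_cards: "card (proj_zeros m (?F ` {1..r})) \<in> cards"
      unfolding assms(7) using independent_extremal_form[OF assms(4)] homogeneous_extremal_form
      by blast
    moreover have "max_zeros q m r \<le> card (proj_zeros m (?F ` {1..r}))"
      unfolding assms(2) by (rule card_proj_zeros_extremal_form[OF assms(3,4)])
    ultimately show "max_zeros q m r \<in> cards" using le by (metis le_antisym)
  qed
  have nu: "\<nu> i = (if i = 1 then 1 else 0) + (if i = r then 1 else 0)" if "i \<in> {1..m + 1}" for i
    using that unfolding assms(5) \<Lambda>_nth_2[OF assms(3,4)]
    by (intro leading_tuples_nth[OF assms(3,4)]) auto
  have j: "j = 1"
    unfolding assms(6) by (rule Min_eqI) (auto simp: nu)
  have max: "int (Max cards) = p_num q (int m - 1) + (if r \<le> m then int q ^ (m - r) else 0)"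
    unfolding Max p_num_eq_sum[OF assms(1)] by (simp add: max_zeros_def)
  have floor: "\<lfloor>real q powi (int m - int r)\<rfloor> = (if r \<le> m then int q ^ (m - r) else 0)"
  proof (cases "r \<le> m")
    case True
    then have "real q powi (int m - int r) = real_of_int (int q ^ (m - r))"
      by (simp add: power_int_def nat_diff_distrib)
    then show ?thesis using True by (simp only: floor_of_int if_True)
  next
    case False
    then have "int m - int r = -1" using assms(4) by simp
    then have "real q powi (int m - int r) = 1 / real q" by (simp add: power_int_minus divide_simps)
    moreover have "\<lfloor>1 / real q\<rfloor> = 0" using q by (intro floor_unique) auto
    ultimately show ?thesis using False by simp
  qed
  have pd: "p_num q (int m - int i) - p_num q (int m - int i - 1) = int q ^ (m - i)" if "i \<le> m" for i
    using p_num_diff[of q "m - i"] that by (simp add: of_nat_diff)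
  have "(\<Sum>i=j..m. int (\<nu> i) * (p_num q (int m - int i) - p_num q (int m - int i - int j)))
      = (\<Sum>i=1..m. (if i = 1 then int q ^ (m - i) else 0) + (if i = r then int q ^ (m - i) else 0))"
    unfolding j by (rule sum.cong) (auto simp: nu pd)
  also have "\<dots> = int q ^ (m - 1) + (if r \<le> m then int q ^ (m - r) else 0)"
    using assms(1,3) by (simp add: sum.distrib)
  also have "int q ^ (m - 1) = p_num q (int m - 1) - p_num q (int m - 2)"
    using pd[of 1] assms(1) by simp
  finally have sum: "p_num q (int m - 2 * int j) +
      (\<Sum>i=j..m. int (\<nu> i) * (p_num q (int m - int i) - p_num q (int m - int i - int j)))
      = p_num q (int m - 1) + (if r \<le> m then int q ^ (m - r) else 0)"
    unfolding j by simp
  show ?thesis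
    unfolding sum max floor using assms(3) by auto
qed

end
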